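(* Under the standing setup below (with $\mathbf q$, $A$, $D$ as there and $q=N_{K_p/\mathbb Q}(\mathbf q)$), one has the equality in $K_{pq}$ $$\Big(\frac{g(\mathbf q)}{\overline{g(\mathbf q)}}\Big)^{p^2}=\Big(\frac{A^2}{D^p}\Big)^{P(\sigma)},$$ where the bar denotes complex conjugation and $x^{P(\sigma)}=\prod_{i=0}^{p-2}\sigma^i(x)^{v^{-i}}$.
   Context: Let $p$ be an odd prime, $\zeta_p$ a primitive $p$-th root of unity, $K_p=\mathbb Q(\zeta_p)$ with ring of integers $\mathbb Z[\zeta_p]$, $K_p^+$ its maximal totally real subfield, $\lambda=\zeta_p-1$, $\pi=\lambda\mathbb Z[\zeta_p]$; $\pi^k\,\|\,x$ means $x\in\pi^k$, $x\notin\pi^{k+1}$. Fix a primitive root $v$ modulo $p$; for $n\in\mathbb Z$, $v^n$ denotes the integer in $\{1,\dots,p-1\}$ congruent to $v^n$ modulo $p$ (for $n<0$ using the inverse of $v$ mod $p$). Let $\sigma\in G_p=\mathrm{Gal}(K_p/\mathbb Q)$ be $\zeta_p\mapsto\zeta_p^v$ and $P(\sigma)=\sum_{i=0}^{p-2}v^{-i}\sigma^i\in\mathbb Z[G_p]$. Gauss sum: for an odd prime $q\ne p$, $\zeta_q$ a primitive $q$-th root of unity, $K_{pq}=\mathbb Q(\zeta_p,\zeta_q)$, and a prime $\mathbf q$ of $\mathbb Z[\zeta_p]$ over $q$ with $N=N\mathbf q$, let $\chi(a)=\{\alpha/\mathbf q\}_p^{-1}$ where $\{\alpha/\mathbf q\}_p$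 is the $p$-th root of unity $\equiv\alpha^{(N-1)/p}\bmod\mathbf q$ ($a\neq0$ the image of $\alpha$ in $\mathbb F_N=\mathbb Z[\zeta_p]/\mathbf q$), $\chi(0)=0$, and $g(\mathbf q)=\sum_{x\in\mathbb F_N}\chi(x)\zeta_q^{\mathrm{Tr}_{\mathbb F_N/\mathbb F_q}(x)}$. Standing setup: assume $p$ is irregular and $p$ does not divide the class number of $K_p^+$. Let $C_p$ be the $p$-Sylow subgroup of the ideal class group of $K_p$, $m$ an integer with $1\le m\le\frac{p-3}{2}$, $\mu=v^{2m+1}$, and $\Gamma\subset C_p$ a subgroup of order $p$ annihilated by $\sigma-\mu$. Let $\mathbf q$ be a non-principal prime ideal of $\mathbb Z[\zeta_p]$ of inertial degree $1$ (so $N\mathbf q=q\equiv1\pmod p$) whose class lies in $\Gamma$, and let $A\in\mathbb Z[\zeta_p]$ with $A\mathbb Z[\zeta_p]=\mathbf q^p$, $\sigma(A)=A^{\mu}\alpha^p$ for some $\alpha\in K_p$, $\pi^{2m+1}\,\|\,A-1$, and $A\overline A=D^p$ for some $D$ in the ring of integers of $K_p^+$. *)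

theory Defs
  imports "HOL-Analysis.Analysis" "HOL-Number_Theory.Number_Theory"
begin

definition cyc_int :: "complex \<Rightarrow> nat \<Rightarrow> complex set" where
  "cyc_int z p = {x. \<exists>c :: nat \<Rightarrow> int. x = (\<Sum>i<p. of_int (c i) * z ^ i)}"

definition cyc_field :: "complex \<Rightarrow> nat \<Rightarrow> complex set" where
  "cyc_field z p = {x. \<exists>c :: nat \<Rightarrow> rat. x = (\<Sum>i<p. of_rat (c i) * z ^ i)}"

text \<open>Ring of integers of the maximal real subfield: Z[zeta] intersected with R.\<close>
definition cyc_int_plus :: "complex \<Rightarrow> nat \<Rightarrow> complex set" where
  "cyc_int_plus z p = {x \<in> cyc_int z p. Im x = 0}"

text \<open>The Galois automorphism zeta |-> zeta^k of Q(zeta) (well defined on Q(zeta)).\<close>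
definition gal_aut :: "complex \<Rightarrow> nat \<Rightarrow> nat \<Rightarrow> complex \<Rightarrow> complex" where
  "gal_aut z p k x = (SOME y. \<exists>c :: nat \<Rightarrow> rat.
      x = (\<Sum>i<p. of_rat (c i) * z ^ i) \<and> y = (\<Sum>i<p. of_rat (c i) * z ^ (k * i)))"

definition is_ideal :: "complex set \<Rightarrow> complex set \<Rightarrow> bool" where
  "is_ideal R I \<longleftrightarrow> I \<subseteq> R \<and> 0 \<in> I \<and> (\<forall>a\<in>I. \<forall>b\<in>I. a + b \<in> I \<and> - a \<in> I)
     \<and> (\<forall>r\<in>R. \<forall>a\<in>I. r * a \<in> I)"

definition nz_ideals :: "complex set \<Rightarrow> complex set set" where
  "nz_ideals R = {I. is_ideal R I \<and> I \<noteq> {0}}"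

definition prime_ideal :: "complex set \<Rightarrow> complex set \<Rightarrow> bool" where
  "prime_ideal R I \<longleftrightarrow> is_ideal R I \<and> I \<noteq> R \<and>
     (\<forall>a\<in>R. \<forall>b\<in>R. a * b \<in> I \<longrightarrow> a \<in> I \<or> b \<in> I)"

definition principal :: "complex set \<Rightarrow> complex \<Rightarrow> complex set" where
  "principal R a = {a * r | r. r \<in> R}"

definition is_principal :: "complex set \<Rightarrow> complex set \<Rightarrow> bool" where
  "is_principal R I \<longleftrightarrow> (\<exists>a\<in>R. I = principal R a)"

definition ideal_prod :: "complex set \<Rightarrow> complex set \<Rightarrow> complex set \<Rightarrow> complex set" where
  "ideal_prod R I J = \<Inter>{K. is_ideal R K \<and> {a * b | a b. a \<in> I \<and> b \<in> J} \<subseteq> K}"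

primrec ideal_pow :: "complex set \<Rightarrow> complex set \<Rightarrow> nat \<Rightarrow> complex set" where
  "ideal_pow R I 0 = R"
| "ideal_pow R I (Suc n) = ideal_prod R I (ideal_pow R I n)"

definition ideal_equiv :: "complex set \<Rightarrow> complex set \<Rightarrow> complex set \<Rightarrow> bool" where
  "ideal_equiv R I J \<longleftrightarrow> (\<exists>a\<in>R. \<exists>b\<in>R. a \<noteq> 0 \<and> b \<noteq> 0 \<and>
      {a * x | x. x \<in> I} = {b * y | y. y \<in> J})"

definition ideal_class :: "complex set \<Rightarrow> complex set \<Rightarrow> complex set set" where
  "ideal_class R I = {J \<in> nz_ideals R. ideal_equiv R I J}"

definition class_group_carrier :: "complex set \<Rightarrow> complex set set set" where
  "class_group_carrier R = ideal_class R ` nz_ideals R"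

definition class_number :: "complex set \<Rightarrow> nat" where
  "class_number R = card (class_group_carrier R)"

text \<open>For a prime Q of Z[zeta_p] of inertial degree 1 over the rational prime l
  (so Z[zeta_p]/Q = F_l and every residue class is represented by an integer),
  the p-th power residue symbol {x/Q}_p of an integer x not in Q.\<close>
definition power_res :: "complex \<Rightarrow> nat \<Rightarrow> nat \<Rightarrow> complex set \<Rightarrow> int \<Rightarrow> complex" where
  "power_res z p l Q x = (THE w. (\<exists>k<p. w = z ^ k) \<and>
      (of_int x) ^ ((l - 1) div p) - w \<in> Q)"

text \<open>Gauss sum g(Q) = sum over F_l (represented by 0..l-1; trace is the identity
  since N Q = l), with chi = {./Q}_p^{-1} and chi(0) = 0.\<close>
definition gauss_sum :: "complex \<Rightarrow> nat \<Rightarrow> complex \<Rightarrow> nat \<Rightarrow> complex set \<Rightarrow> complex" where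
  "gauss_sum zp p zq l Q = (\<Sum>x\<in>{1..<l}. inverse (power_res zp p l Q (int x)) * zq ^ x)"

text \<open>v^{-i} as the integer in {1..p-1}: (v^{-1})^i mod p with v^{-1} = v^{p-2} mod p.\<close>
definition vneg :: "nat \<Rightarrow> nat \<Rightarrow> nat \<Rightarrow> nat" where
  "vneg p v i = (v ^ ((p - 2) * i)) mod p"

definition P_sigma_pow :: "complex \<Rightarrow> nat \<Rightarrow> nat \<Rightarrow> complex \<Rightarrow> complex" where
  "P_sigma_pow z p v x = (\<Prod>i\<in>{0..p-2}. ((gal_aut z p v ^^ i) x) ^ (vneg p v i))"

end

theory Submission
  imports Defs
begin

text \<open>
  Put \<open>w = g(Q) ^ (p * p)\<close> and let \<open>A ^ P\<close> be the Stickelberger power of \<open>A\<close>. In fact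
  \<open>w = - A ^ P\<close>, and the theorem follows by dividing this equation by its complex conjugate.

  The ring \<open>Z[zeta]\<close> consists of the values \<open>f(zeta)\<close> of integer polynomials. Because \<open>Q\<close> has degree one,
  \<open>zeta\<close> lifts to an integer \<open>k\<close> with \<open>k ^ p = 1\<close> modulo \<open>l ^ M\<close>, and the valuations at the conjugates of
  \<open>Q\<close> can be read off from the integers \<open>f(k ^ t)\<close>; no factorisation theory of ideals is needed.
  Writing \<open>g(Q) ^ p\<close> as \<open>l\<close> times a product of Jacobi sums and reducing those modulo \<open>l\<close> to power sums
  gives enough of Stickelberger's theorem to see that \<open>u = w / A ^ P\<close> lies in \<open>Z[zeta]\<close>. Since
  \<open>|g(Q)| ^ 2 = l\<close> and \<open>A\<close> has norm \<open>l ^ p\<close>, all conjugates of \<open>u\<close> have absolute value one. Jacobi sums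
  are \<open>-1\<close> modulo \<open>(zeta - 1) ^ 2\<close> and \<open>A\<close> is \<open>1\<close>, so \<open>- u\<close> is \<open>1\<close> modulo \<open>(zeta - 1) ^ 2\<close>. An
  element with these two properties equals \<open>1\<close>: its \<open>(p * p)\<close>-th power minus \<open>1\<close> is divisible by \<open>p * p\<close>
  but has conjugates of absolute value at most two, hence vanishes, and no nontrivial \<open>p\<close>-th root of
  unity is \<open>1\<close> modulo \<open>(zeta - 1) ^ 2\<close>.
\<close>

hide_const (open) Module.smult UnivPoly.monom UnivPoly.coeff

section \<open>Integer polynomials and the cyclotomic polynomial\<close>

text \<open>A polynomial represents the element \<open>f(zeta)\<close>. The same \<open>f\<close>
  can be evaluated at every conjugate of zeta and, through \<open>poly\<close>, at integers that
  imitate zeta modulo a power of \<open>l\<close>.\<close>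

definition ev :: "int poly \<Rightarrow> complex \<Rightarrow> complex" where
  "ev f x = poly (map_poly of_int f) x"

lemma ev_0 [simp]: "ev 0 x = 0"
  by (simp add: ev_def)

lemma ev_pCons [simp]: "ev (pCons a f) x = of_int a + x * ev f x"
  by (simp add: ev_def map_poly_pCons)

lemma ev_1 [simp]: "ev 1 x = 1"
  by (simp add: one_pCons)

lemma ev_add [simp]: "ev (f + g) x = ev f x + ev g x"
  by (induction f g rule: poly_induct2) (simp_all add: algebra_simps)

lemma ev_uminus [simp]: "ev (- f) x = - ev f x"
  by (induction f) simp_all

lemma ev_diff [simp]: "ev (f - g) x = ev f x - ev g x"
  using ev_add[of f "- g"] by simp

lemma ev_smult [simp]: "ev (smult a f) x = of_int a * ev f x"
  by (induction f) (simp_all add: algebra_simps)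

lemma ev_mult [simp]: "ev (f * g) x = ev f x * ev g x"
  by (induction f) (simp_all add: algebra_simps)

lemma ev_power [simp]: "ev (f ^ n) x = ev f x ^ n"
  by (induction n) simp_all

lemma ev_sum [simp]: "ev (sum f S) x = (\<Sum>i\<in>S. ev (f i) x)"
  by (induction S rule: infinite_finite_induct) simp_all

lemma ev_prod [simp]: "ev (prod f S) x = (\<Prod>i\<in>S. ev (f i) x)"
  by (induction S rule: infinite_finite_induct) simp_all

lemma ev_monom [simp]: "ev (monom a n) x = of_int a * x ^ n"
  by (induction n) (simp_all add: monom_0 monom_Suc)

lemma ev_pcompose [simp]: "ev (pcompose f g) x = ev f (ev g x)"
  by (induction f) (simp_all add: pcompose_pCons)

lemma ev_of_int [simp]: "ev (of_int a) x = of_int a"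
  by (simp add: of_int_poly)

lemma ev_of_nat [simp]: "ev (of_nat a) x = of_nat a"
  by (simp add: of_nat_poly)

lemma ev_at_int: "ev f (of_int a) = of_int (poly f a)"
  by (induction f) simp_all

lemma cnj_ev: "cnj (ev f x) = ev f (cnj x)"
  by (induction f) simp_all

section \<open>Coefficient sums, monic division and Eisenstein's criterion\<close>

lemma ev_eq_sum_less:
  assumes "degree f < n"
  shows "ev f x = (\<Sum>i<n. of_int (coeff f i) * x ^ i)"
proof -
  have "f = (\<Sum>i<n. monom (coeff f i) i)"
  proof (rule poly_eqI)
    fix j
    have "coeff (\<Sum>i<n. monom (coeff f i) i) j = (\<Sum>i<n. if i = j then coeff f i else 0)"
      by (simp add: coeff_sum)
    also have "\<dots> = coeff f j"
      using assms by (auto simp: coeff_eq_0)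
    finally show "coeff f j = coeff (\<Sum>i<n. monom (coeff f i) i) j" by simp
  qed
  then have "ev f x = ev (\<Sum>i<n. monom (coeff f i) i) x" by simp
  then show ?thesis by simp
qed

lemma poly_eq_sum_less:
  fixes f :: "int poly"
  assumes "degree f < n"
  shows "poly f x = (\<Sum>i<n. coeff f i * x ^ i)"
proof -
  have "of_int (poly f x) = (of_int (\<Sum>i<n. coeff f i * x ^ i) :: complex)"
    using ev_eq_sum_less[OF assms, of "of_int x"] by (simp add: ev_at_int)
  then show ?thesis using of_int_eq_iff by blast
qed

text \<open>Pseudo-division scales the dividend by a power of the leading coefficient of
  \<open>g\<close>, which is 1 here, so it is genuine division over the integers.\<close>

lemma monic_division:
  fixes f g :: "int poly"
  assumes "lead_coeff g = 1" "0 < degree g"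
  obtains q r where "f = g * q + r" "degree r < degree g"
proof -
  obtain q r where qr: "pseudo_divmod f g = (q, r)" by force
  have "g \<noteq> 0" using assms by auto
  from pseudo_divmod[OF this qr] show ?thesis
    using assms that[of q r] by auto
qed

text \<open>Let \<open>i\<close> be the least index with \<open>P\<close> not dividing
  \<open>coeff f i\<close>. In coefficient \<open>i\<close> of the product every summand except
  \<open>coeff f i * coeff g 0\<close> is divisible by \<open>P\<close>, so \<open>i\<close> cannot
  lie below the degree of the product. Since \<open>i \<le> degree f\<close>, the factor
  \<open>g\<close> is constant.\<close>

lemma eisenstein_aux:
  fixes f g :: "int poly" and P :: int
  assumes "prime P" "\<And>i. i < degree (f * g) \<Longrightarrow> P dvd coeff (f * g) i"
    and "\<not> P dvd lead_coeff (f * g)"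
    and "P dvd coeff f 0" "\<not> P dvd coeff g 0"
  shows "degree g = 0"
proof (rule ccontr)
  assume g: "degree g \<noteq> 0"
  have nz: "f \<noteq> 0" "g \<noteq> 0" using assms by auto
  have "\<not> P dvd coeff f (degree f)"
    using assms(3) by (auto simp: lead_coeff_mult)
  define i where "i = (LEAST i. \<not> P dvd coeff f i)"
  have i: "\<not> P dvd coeff f i"
    unfolding i_def by (rule LeastI) fact
  have less: "P dvd coeff f j" if "j < i" for j
    using that not_less_Least unfolding i_def by blast
  have "i \<le> degree f"
    unfolding i_def by (rule Least_le) fact
  then have "P dvd coeff (f * g) i"
    using g nz by (intro assms(2)) (auto simp: degree_mult_eq)
  also have "coeff (f * g) i = (\<Sum>j<i. coeff f j * coeff g (i - j)) + coeff f i * coeff g 0"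
    by (simp add: coeff_mult lessThan_Suc_atMost[symmetric])
  finally have "P dvd coeff f i * coeff g 0"
    using less by (subst (asm) dvd_add_right_iff) (auto intro!: dvd_sum)
  then show False
    using i assms(1,5) by (simp add: prime_dvd_mult_iff)
qed

lemma eisenstein:
  fixes f g :: "int poly" and P :: int
  assumes "prime P" "\<And>i. i < degree (f * g) \<Longrightarrow> P dvd coeff (f * g) i"
    and "\<not> P dvd lead_coeff (f * g)" "\<not> P\<^sup>2 dvd coeff (f * g) 0"
  shows "degree f = 0 \<or> degree g = 0"
proof (rule ccontr)
  assume *: "\<not> ?thesis"
  have nz: "f \<noteq> 0" "g \<noteq> 0" using assms by auto
  have "P dvd coeff f 0 * coeff g 0"
    using * assms(2)[of 0] nz by (auto simp: degree_mult_eq coeff_mult)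
  moreover have "\<not> (P dvd coeff f 0 \<and> P dvd coeff g 0)"
    using assms(4) by (auto simp: coeff_mult power2_eq_square intro: mult_dvd_mono)
  ultimately consider "P dvd coeff f 0" "\<not> P dvd coeff g 0" | "P dvd coeff g 0" "\<not> P dvd coeff f 0"
    using assms(1) by (auto simp: prime_dvd_mult_iff)
  then show False
    using eisenstein_aux[of P f g] eisenstein_aux[of P g f] assms * by cases (auto simp: mult.commute)
qed

section \<open>The cyclotomic polynomial of prime index\<close>

definition cyclotomic_prime :: "nat \<Rightarrow> int poly" where
  "cyclotomic_prime p = (\<Sum>i<p. monom 1 i)"

lemma coeff_cyclotomic_prime: "coeff (cyclotomic_prime p) i = (if i < p then 1 else 0)"
  by (simp add: cyclotomic_prime_def coeff_sum)

lemma degree_cyclotomic_prime: "degree (cyclotomic_prime p) = p - 1"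
proof (cases "p = 0")
  case False
  then have "degree (cyclotomic_prime p) \<le> p - 1"
    by (intro degree_le) (auto simp: coeff_cyclotomic_prime)
  moreover have "p - 1 \<le> degree (cyclotomic_prime p)"
    using False by (intro le_degree) (auto simp: coeff_cyclotomic_prime)
  ultimately show ?thesis by simp
qed (simp add: cyclotomic_prime_def)

lemma lead_coeff_cyclotomic_prime: "p > 0 \<Longrightarrow> lead_coeff (cyclotomic_prime p) = 1"
  by (simp add: degree_cyclotomic_prime coeff_cyclotomic_prime)

lemma poly_cyclotomic_prime_1: "poly (cyclotomic_prime p) 1 = int p"
  by (simp add: cyclotomic_prime_def poly_sum poly_monom)

lemma cyclotomic_prime_mult: "[:-1, 1:] * cyclotomic_prime p = monom 1 p - 1"
proof (rule poly_eqI)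
  show "coeff ([:- 1, 1:] * cyclotomic_prime p) n = coeff (monom 1 p - 1) n" for n
    by (cases n) (auto simp: coeff_cyclotomic_prime coeff_pCons)
qed

lemma poly_cyclotomic_prime_mult: "(x - 1) * poly (cyclotomic_prime p) x = x ^ p - 1"
  using arg_cong[OF cyclotomic_prime_mult, of "\<lambda>f. poly f x" p]
  by (simp add: poly_monom algebra_simps)

lemma pcompose_monom: "pcompose (monom 1 n) f = f ^ n"
  by (induction n) (simp_all add: monom_Suc pcompose_pCons pcompose_1 flip: one_pCons)

text \<open>The shifted polynomial is \<open>((1 + x) ^ p - 1) / x\<close>. Its coefficients are
  binomial coefficients, which brings it into the form that Eisenstein's criterion at
  \<open>p\<close> requires.\<close>

lemma coeff_cyclotomic_prime_shift:
  "coeff (pcompose (cyclotomic_prime p) [:1, 1:]) i = int (p choose (Suc i))"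
proof -
  \<comment> \<open>Prepending a zero coefficient multiplies by \<open>x\<close>, and
    \<open>x\<close> is the shift of \<open>x - 1\<close>.\<close>
  have "pCons 0 (pcompose (cyclotomic_prime p) [:1, 1:]) = pcompose ([:-1, 1:] * cyclotomic_prime p) [:1, 1:]"
    by (simp only: pcompose_mult) (simp add: pcompose_pCons)
  also have "\<dots> = [:1, 1:] ^ p - 1"
    by (simp only: cyclotomic_prime_mult) (simp add: pcompose_diff pcompose_1 pcompose_monom)
  finally have "coeff (pcompose (cyclotomic_prime p) [:1, 1:]) i = coeff ([:1, 1:] ^ p - 1 :: int poly) (Suc i)"
    by (metis coeff_pCons_Suc)
  also have "\<dots> = int (p choose (Suc i))"
    by (cases "Suc i \<le> p") (simp_all add: coeff_linear_poly_power binomial_eq_0 coeff_eq_0 degree_power_eq del: power_Suc)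
  finally show ?thesis .
qed

lemma ev_cyclotomic_prime:
  assumes "w ^ p = 1" "w \<noteq> 1"
  shows "ev (cyclotomic_prime p) w = 0"
proof -
  have "(w - 1) * ev (cyclotomic_prime p) w = ev ([:-1, 1:] * cyclotomic_prime p) w"
    by (simp only: ev_mult) (simp add: algebra_simps)
  also have "\<dots> = 0" using assms by (simp only: cyclotomic_prime_mult) simp
  finally show ?thesis using assms by simp
qed

text \<open>A polynomial of least degree vanishing at \<open>w\<close>, made primitive, divides the
  cyclotomic polynomial over the integers. Eisenstein's criterion after the shift
  \<open>x + 1\<close> makes one factor constant. A degree below \<open>p - 1\<close> forces this to
  be the factor vanishing at \<open>w\<close>, which is absurd.\<close>

lemma cyclotomic_prime_minimal:
  assumes p: "prime p" and w: "w ^ p = 1" "w \<noteq> 1"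
    and f: "ev f w = 0" "degree f < p - 1"
  shows "f = 0"
proof (rule ccontr)
  assume "f \<noteq> 0"
  define P where "P = (\<lambda>g. g \<noteq> 0 \<and> ev g w = 0)"
  have "P f" using f \<open>f \<noteq> 0\<close> by (simp add: P_def)
  then obtain r where r: "P r" "\<And>g. P g \<Longrightarrow> degree r \<le> degree g"
    using ex_has_least_nat[of P f degree] by blast
  define r' where "r' = primitive_part r"
  have r_eq: "r = smult (content r) r'" by (simp add: r'_def)
  have "r \<noteq> 0" "ev r w = 0" using r by (auto simp: P_def)
  have r': "r' \<noteq> 0" "content r' = 1" "degree r' = degree r"
    using \<open>r \<noteq> 0\<close> by (auto simp: r'_def)
  have "of_int (content r) * ev r' w = 0"
    using \<open>ev r w = 0\<close> r_eq ev_smult by metis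
  then have ev_r': "ev r' w = 0" using \<open>r \<noteq> 0\<close> by simp
  \<comment> \<open>The pseudo-remainder also vanishes at \<open>w\<close>, so the minimality of the
    degree makes it zero.\<close>
  define s where "s = pseudo_mod (cyclotomic_prime p) r'"
  obtain a q where aq: "a \<noteq> 0" "smult a (cyclotomic_prime p) = r' * q + s"
    using pseudo_mod(1)[OF r'(1), of "cyclotomic_prime p"] unfolding s_def by blast
  have "s = 0 \<or> degree s < degree r'"
    using pseudo_mod(2)[OF r'(1)] unfolding s_def by blast
  moreover have "ev s w = 0"
    using arg_cong[OF aq(2), of "\<lambda>g. ev g w"] ev_r' ev_cyclotomic_prime[OF w] by simp
  ultimately have "s = 0"
    using r(2)[of s] r'(3) unfolding P_def by (metis not_less)
  then have eq: "smult a (cyclotomic_prime p) = r' * q" using aq by simp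
  \<comment> \<open>Gauss's lemma: as \<open>r'\<close> is primitive, the content of
    \<open>r' * q\<close> is that of \<open>q\<close>, so the scalar \<open>a\<close> can be
    cancelled from the factorisation.\<close>
  have "a dvd content (smult a (cyclotomic_prime p))" by simp
  then have "a dvd content q"
    unfolding eq content_mult using r'(2) by simp
  then obtain q' where q': "q = [:a:] * q'"
    by (auto simp: const_poly_dvd_iff_dvd_content[symmetric] elim: dvdE)
  have "smult a (cyclotomic_prime p) = smult a (r' * q')"
    using eq q' by simp
  then have fact: "cyclotomic_prime p = r' * q'"
    using aq(1) by (metis smult_cancel)
  have p2: "p \<ge> 2" using p prime_ge_2_nat by blast
  have q'_nz: "q' \<noteq> 0"
    using fact lead_coeff_cyclotomic_prime[of p] p2 by auto
  have deg: "degree r' + degree q' = p - 1"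
    using degree_cyclotomic_prime[of p] r'(1) q'_nz by (simp add: fact degree_mult_eq)
  define F where "F = pcompose r' [:1, 1:]"
  define G where "G = pcompose q' [:1, 1:]"
  have FG: "F * G = pcompose (cyclotomic_prime p) [:1, 1:]"
    by (simp add: F_def G_def fact pcompose_mult)
  have degF: "degree F = degree r'" "degree G = degree q'"
    by (simp_all add: F_def G_def degree_pcompose)
  have degFG: "degree (F * G) = p - 1"
    by (simp add: FG degree_pcompose degree_cyclotomic_prime)
  have "degree F = 0 \<or> degree G = 0"
  proof (rule eisenstein[of "int p"])
    show "prime (int p)" using p by simp
    show "int p dvd coeff (F * G) i" if "i < degree (F * G)" for i
      using that p unfolding degFG by (auto simp: FG coeff_cyclotomic_prime_shift intro!: dvd_choose_prime)
    show "\<not> int p dvd lead_coeff (F * G)"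
      using p2 unfolding degFG by (simp add: FG coeff_cyclotomic_prime_shift)
    show "\<not> (int p)\<^sup>2 dvd coeff (F * G) 0"
    proof
      assume "(int p)\<^sup>2 dvd coeff (F * G) 0"
      then have "int (p * p) dvd int p"
        unfolding FG coeff_cyclotomic_prime_shift by (simp add: power2_eq_square)
      then show False using p2 by (simp only: int_dvd_int_iff) (auto dest: dvd_imp_le)
    qed
  qed
  moreover have "degree r' < p - 1"
    using f r(2)[OF \<open>P f\<close>] r'(3) by simp
  ultimately have "degree r' = 0" using degF deg by auto
  then obtain c where "r' = [:c:]" by (auto elim: degree_eq_zeroE)
  then show False using ev_r' r'(1) by simp
qed

lemma cyclotomic_prime_dvd:
  assumes p: "prime p" and w: "w ^ p = 1" "w \<noteq> 1" and f: "ev f w = 0"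
  shows "cyclotomic_prime p dvd f"
proof -
  have p2: "p \<ge> 2" using p prime_ge_2_nat by blast
  obtain q r where qr: "f = cyclotomic_prime p * q + r" "degree r < degree (cyclotomic_prime p)"
    using p2 monic_division[of "cyclotomic_prime p" f]
    by (auto simp: coeff_cyclotomic_prime degree_cyclotomic_prime)
  have "ev r w = 0"
    using f qr(1) ev_cyclotomic_prime[OF w] by simp
  then have "r = 0"
    using cyclotomic_prime_minimal[OF p w] qr(2) by (simp add: degree_cyclotomic_prime)
  then show ?thesis using qr by simp
qed

text \<open>The difference is a multiple of the cyclotomic polynomial, which vanishes at every
  nontrivial root of unity. This transfer plays the part of the Galois automorphisms.\<close>

lemma ev_eq_transfer:
  assumes "prime p" "w ^ p = 1" "w \<noteq> 1" "ev f w = ev g w" "w' ^ p = 1" "w' \<noteq> 1"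
  shows "ev f w' = ev g w'"
proof -
  have "cyclotomic_prime p dvd f - g"
    using assms by (intro cyclotomic_prime_dvd) auto
  then obtain h where "f - g = cyclotomic_prime p * h" ..
  then have "ev (f - g) w' = 0"
    using ev_cyclotomic_prime[OF assms(5,6)] by simp
  then show ?thesis by simp
qed

text \<open>Division with remainder by \<open>x ^ p - 1\<close>. The quotient is kept for integer
  arguments, which are \<open>p\<close>-th roots of 1 only modulo a power of
  \<open>l\<close>.\<close>

lemma reduce_mod_power_minus_1:
  assumes "p > 0"
  obtains c :: "nat \<Rightarrow> int" and q :: "int poly" where
    "\<And>w. w ^ p = 1 \<Longrightarrow> ev f w = (\<Sum>i<p. of_int (c i) * w ^ i)"
    "\<And>x. poly f x = (\<Sum>i<p. c i * x ^ i) + (x ^ p - 1) * poly q x"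
proof -
  define g :: "int poly" where "g = monom 1 p - 1"
  have deg: "degree g = p"
    using assms degree_add_eq_left[of "-1" "monom (1::int) p"]
    by (simp add: g_def degree_monom_eq)
  then have "lead_coeff g = 1"
    using assms by (simp add: g_def)
  then obtain q r where qr: "f = g * q + r" "degree r < degree g"
    using monic_division[of g f] deg assms by auto
  show ?thesis
  proof (rule that[of "coeff r" q])
    show "ev f w = (\<Sum>i<p. of_int (coeff r i) * w ^ i)" if "w ^ p = 1" for w
      using that qr deg by (simp add: g_def ev_eq_sum_less[of r p])
    show "poly f x = (\<Sum>i<p. coeff r i * x ^ i) + (x ^ p - 1) * poly q x" for x
      using qr deg by (simp add: g_def poly_monom poly_eq_sum_less[of r p])
  qed
qed

section \<open>The ring of integers and its automorphisms\<close>

lemma bij_betw_mult_mod_prime: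
  fixes p s :: nat
  assumes "prime p" "\<not> p dvd s"
  shows "bij_betw (\<lambda>t. s * t mod p) {1..<p} {1..<p}"
proof -
  have cop: "coprime s p"
    using assms prime_imp_coprime coprime_commute by blast
  have inj: "inj_on (\<lambda>t. s * t mod p) {1..<p}"
  proof (rule inj_onI)
    fix a b assume ab: "a \<in> {1..<p}" "b \<in> {1..<p}" "s * a mod p = s * b mod p"
    then have "[a = b] (mod p)"
      using cop cong_mult_lcancel_nat unfolding cong_def by blast
    then show "a = b" using ab by (simp add: cong_def)
  qed
  have "(\<lambda>t. s * t mod p) ` {1..<p} \<subseteq> {1..<p}"
  proof safe
    fix t assume t: "t \<in> {1..<p}"
    then have "\<not> p dvd s * t"
      using assms by (auto simp: prime_dvd_mult_iff dest: dvd_imp_le)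
    then have "s * t mod p \<noteq> 0" by (simp add: dvd_eq_mod_eq_0)
    moreover have "s * t mod p < p" using t by simp
    ultimately show "s * t mod p \<in> {1..<p}" by simp
  qed
  then have "(\<lambda>t. s * t mod p) ` {1..<p} = {1..<p}"
    using inj by (intro endo_inj_surj) auto
  then show ?thesis using inj by (simp add: bij_betw_def)
qed

lemma power_mod_exponent:
  fixes w :: complex
  assumes "w ^ p = 1"
  shows "w ^ (n mod p) = w ^ n"
proof -
  have "w ^ n = w ^ (p * (n div p) + n mod p)" by simp
  also have "\<dots> = w ^ (n mod p)"
    using assms by (simp only: power_add power_mult) simp
  finally show ?thesis by simp
qed

lemma power_root_cong:
  fixes w :: complex
  assumes "w ^ p = 1" "[a = b] (mod p)"
  shows "w ^ a = w ^ b"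
  using assms power_mod_exponent by (metis cong_def)

lemma cnj_root_of_unity:
  assumes "w ^ p = 1" "p > 0"
  shows "cnj w = w ^ (p - 1)" "norm w = 1" "cnj w = inverse w"
proof -
  show n: "norm w = 1"
    using power_eq_1_iff[OF assms(1)] assms(2) by simp
  then have "w * cnj w = 1" by (simp flip: complex_norm_square)
  moreover have "w * w ^ (p - 1) = 1" using assms by (simp add: power_eq_if)
  ultimately have "w * cnj w = w * w ^ (p - 1)" by simp
  moreover have "w \<noteq> 0" using n by auto
  ultimately show "cnj w = w ^ (p - 1)" by simp
  show "cnj w = inverse w"
    using inverse_unique[OF \<open>w * cnj w = 1\<close>] by simp
qed

text \<open>It turns the rational coefficients in \<open>gal_aut\<close> into integer ones, to which
  the transfer between conjugates applies.\<close>

lemma common_denominator: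
  fixes c :: "nat \<Rightarrow> rat"
  assumes "finite S"
  obtains N :: int and d :: "nat \<Rightarrow> int" where "N \<noteq> 0" "\<And>i. i \<in> S \<Longrightarrow> of_int N * c i = of_int (d i)"
proof -
  have "\<exists>N d. N \<noteq> 0 \<and> (\<forall>i\<in>S. of_int N * c i = of_int (d i :: int))"
    using assms
  proof (induction S)
    case empty
    then show ?case by (auto intro: exI[of _ 1])
  next
    case (insert j S)
    then obtain N d where N: "N \<noteq> 0" "\<forall>i\<in>S. of_int N * c i = of_int (d i :: int)" by blast
    obtain a b where ab: "c j = Fract a b" "b > 0" by (cases "c j") auto
    have "\<forall>i\<in>insert j S. of_int (N * b) * c i = of_int ((if i = j then N * a else b * d i))"
      using N ab insert by (auto simp: Fract_of_int_quotient)
    moreover have "N * b \<noteq> 0" using N ab by simp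
    ultimately show ?case
      by (intro exI[of _ "N * b"] exI[of _ "\<lambda>i. if i = j then N * a else b * d i"]) simp
  qed
  then show ?thesis using that by blast
qed

section \<open>The ring \<open>Z[zeta]\<close> as values of integer polynomials, and
  conjugation\<close>

locale prime_cyclotomic =
  fixes p :: nat and z :: complex
  assumes p_prime: "prime p" and p_odd: "odd p" and z_power: "z ^ p = 1" and z_neq_1: "z \<noteq> 1"
begin

abbreviation R where "R \<equiv> cyc_int z p"
abbreviation lam where "lam \<equiv> z - 1"

lemma p_ge_3: "p \<ge> 3"
  using p_prime p_odd prime_ge_2_nat[of p] by (cases "p = 2") auto

lemma p_gt_0 [simp]: "p > 0" and p_neq_0 [simp]: "p \<noteq> 0" and p_gt_1: "p > 1"
  using p_ge_3 by auto

lemma cyc_int_iff: "x \<in> R \<longleftrightarrow> (\<exists>f. x = ev f z)"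
proof
  assume "x \<in> R"
  then obtain c :: "nat \<Rightarrow> int" where "x = (\<Sum>i<p. of_int (c i) * z ^ i)"
    by (auto simp: cyc_int_def)
  then have "x = ev (\<Sum>i<p. monom (c i) i) z" by simp
  then show "\<exists>f. x = ev f z" by blast
next
  assume "\<exists>f. x = ev f z"
  then obtain f where f: "x = ev f z" ..
  obtain c :: "nat \<Rightarrow> int" where "\<And>w. w ^ p = 1 \<Longrightarrow> ev f w = (\<Sum>i<p. of_int (c i) * w ^ i)"
    using reduce_mod_power_minus_1[of p f] by (metis p_gt_0)
  then have "x = (\<Sum>i<p. of_int (c i) * z ^ i)" using f z_power by blast
  then show "x \<in> R" unfolding cyc_int_def by blast
qed

lemma ev_in_R [simp, intro]: "ev f z \<in> R"
  by (auto simp: cyc_int_iff)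

lemma R_add [simp, intro]: "x \<in> R \<Longrightarrow> y \<in> R \<Longrightarrow> x + y \<in> R"
  by (metis cyc_int_iff ev_add)

lemma R_mult [simp, intro]: "x \<in> R \<Longrightarrow> y \<in> R \<Longrightarrow> x * y \<in> R"
  by (metis cyc_int_iff ev_mult)

lemma R_uminus [simp, intro]: "x \<in> R \<Longrightarrow> - x \<in> R"
  by (metis cyc_int_iff ev_uminus)

lemma R_diff [simp, intro]: "x \<in> R \<Longrightarrow> y \<in> R \<Longrightarrow> x - y \<in> R"
  by (metis cyc_int_iff ev_diff)

lemma R_of_int [simp, intro]: "of_int a \<in> R"
  by (metis cyc_int_iff ev_of_int)

lemma R_of_nat [simp, intro]: "of_nat a \<in> R"
  by (metis R_of_int of_int_of_nat_eq)

lemma R_0 [simp, intro]: "0 \<in> R" and R_1 [simp, intro]: "1 \<in> R"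
  using R_of_int[of 0] R_of_int[of 1] by simp_all

lemma R_power [simp, intro]: "x \<in> R \<Longrightarrow> x ^ n \<in> R"
  by (induction n) auto

lemma R_sum [simp, intro]: "(\<And>i. i \<in> S \<Longrightarrow> f i \<in> R) \<Longrightarrow> sum f S \<in> R"
  by (induction S rule: infinite_finite_induct) auto

lemma R_prod [simp, intro]: "(\<And>i. i \<in> S \<Longrightarrow> f i \<in> R) \<Longrightarrow> prod f S \<in> R"
  by (induction S rule: infinite_finite_induct) auto

lemma z_in_R [simp, intro]: "z \<in> R"
  using ev_in_R[of "monom 1 1"] by simp

lemma z_power_eq_1_iff: "z ^ n = 1 \<longleftrightarrow> p dvd n"
proof
  assume n: "z ^ n = 1"
  show "p dvd n"
  proof (rule ccontr)
    assume "\<not> p dvd n"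
    then have "coprime n p"
      using p_prime prime_imp_coprime coprime_commute by blast
    then obtain m where "[n * m = 1] (mod p)" using cong_solve_coprime_nat[of n p] by auto
    then have "z ^ (n * m) = z ^ 1" using power_root_cong z_power by blast
    then show False using n z_neq_1 by (simp add: power_mult)
  qed
qed (auto simp: power_mult z_power elim!: dvdE)

lemma z_power_root [simp]: "(z ^ t) ^ p = 1"
  by (simp flip: power_mult add: mult.commute[of t]) (simp add: power_mult z_power)

lemma z_power_neq_1: "\<not> p dvd t \<Longrightarrow> z ^ t \<noteq> 1"
  by (simp add: z_power_eq_1_iff)

lemma not_dvd_range: "t \<in> {1..<p} \<Longrightarrow> \<not> p dvd t"
  by (auto dest: dvd_imp_le)

lemma ev_eq_conj:
  assumes "ev f z = ev g z" "\<not> p dvd t"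
  shows "ev f (z ^ t) = ev g (z ^ t)"
  using ev_eq_transfer[OF p_prime z_power z_neq_1 assms(1)] z_power_neq_1[OF assms(2)] by simp

lemma ev_eq_0_conj:
  assumes "ev f (z ^ t) = 0" "\<not> p dvd t"
  shows "ev f z = 0"
  using ev_eq_transfer[OF p_prime _ _ _ z_power z_neq_1, of "z ^ t" f 0] z_power_neq_1[OF assms(2)] assms
  by simp

lemma cnj_ev_z: "t \<le> p \<Longrightarrow> cnj (ev f (z ^ t)) = ev f (z ^ (p - t))"
proof -
  assume "t \<le> p"
  have "z ^ t * z ^ (p - t) = 1" using \<open>t \<le> p\<close> by (simp flip: power_add add: z_power)
  then have "cnj (z ^ t) = z ^ (p - t)"
    using cnj_root_of_unity(3)[of "z ^ t" p] by (metis inverse_unique p_gt_0 z_power_root)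
  then show ?thesis by (simp add: cnj_ev)
qed

text \<open>The \<open>p\<close> coefficients of an element are not unique, so the choice in
  \<open>gal_aut\<close> must be shown harmless: after clearing denominators, two representations
  that agree at \<open>z\<close> agree at \<open>z ^ t\<close>.\<close>

lemma gal_aut_ev:
  assumes "\<not> p dvd t" "n \<noteq> 0"
  shows "gal_aut z p t (ev f z / of_int n) = ev f (z ^ t) / of_int n"
proof -
  define Q where "Q = (\<lambda>y. \<exists>c :: nat \<Rightarrow> rat. ev f z / of_int n = (\<Sum>i<p. of_rat (c i) * z ^ i)
    \<and> y = (\<Sum>i<p. of_rat (c i) * z ^ (t * i)))"
  obtain c :: "nat \<Rightarrow> int" where c: "\<And>w. w ^ p = 1 \<Longrightarrow> ev f w = (\<Sum>i<p. of_int (c i) * w ^ i)"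
    using reduce_mod_power_minus_1[of p f] by (metis p_gt_0)
  have "Q (ev f (z ^ t) / of_int n)"
    unfolding Q_def
    by (rule exI[of _ "\<lambda>i. of_int (c i) / of_int n"])
       (simp add: c z_power of_rat_divide sum_divide_distrib power_mult)
  moreover have "y = ev f (z ^ t) / of_int n" if "Q y" for y
  proof -
    obtain b :: "nat \<Rightarrow> rat" where b: "ev f z / of_int n = (\<Sum>i<p. of_rat (b i) * z ^ i)"
      "y = (\<Sum>i<p. of_rat (b i) * z ^ (t * i))"
      using \<open>Q y\<close> unfolding Q_def by blast
    obtain N d where N: "N \<noteq> 0" "\<And>i. i \<in> {..<p} \<Longrightarrow> of_int N * b i = of_int (d i)"
      using common_denominator[of "{..<p}" b] by auto
    have N': "of_int N * of_rat (b i) = (of_int (d i) :: complex)" if "i < p" for i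
      using arg_cong[OF N(2)[of i], of "of_rat :: rat \<Rightarrow> complex"] that
      by (simp add: of_rat_mult)
    define h where "h = (\<Sum>i<p. monom (d i) i)"
    have h: "ev h w = of_int N * (\<Sum>i<p. of_rat (b i) * w ^ i)" for w
      by (simp add: h_def sum_distrib_left N' mult.assoc[symmetric])
    have "ev (smult n h) z = ev (smult N f) z"
      using h[of z] b(1) \<open>n \<noteq> 0\<close> by (simp add: field_simps)
    then have "ev (smult n h) (z ^ t) = ev (smult N f) (z ^ t)"
      by (rule ev_eq_conj) fact
    moreover have "ev h (z ^ t) = of_int N * y"
      using h[of "z ^ t"] b(2) by (simp add: power_mult)
    ultimately show ?thesis
      using N(1) \<open>n \<noteq> 0\<close> by (simp add: field_simps)
  qed
  ultimately have "(SOME y. Q y) = ev f (z ^ t) / of_int n"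
    by (metis someI)
  then show ?thesis unfolding gal_aut_def Q_def by simp
qed

lemma gal_aut_funpow_ev:
  assumes "\<not> p dvd t" "n \<noteq> 0"
  shows "(gal_aut z p t ^^ i) (ev f z / of_int n) = ev f (z ^ (t ^ i)) / of_int n"
proof (induction i)
  case (Suc i)
  have "(gal_aut z p t ^^ Suc i) (ev f z / of_int n)
      = gal_aut z p t (ev (pcompose f (monom 1 (t ^ i))) z / of_int n)"
    using Suc by simp
  also have "\<dots> = ev (pcompose f (monom 1 (t ^ i))) (z ^ t) / of_int n"
    using assms by (rule gal_aut_ev)
  also have "\<dots> = ev f (z ^ (t ^ Suc i)) / of_int n"
    by (simp flip: power_mult)
  finally show ?case .
qed simp

text \<open>The product of conjugates, as a polynomial \<open>F\<close>, has the same value at all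
  nontrivial roots. Its remainder \<open>r\<close> modulo the cyclotomic polynomial therefore
  satisfies \<open>(p - 1) * r(z) = n\<close> with the integer trace \<open>n\<close>, and
  minimality of the cyclotomic polynomial makes \<open>r\<close> constant.\<close>

lemma norm_is_int:
  obtains N :: int where "(\<Prod>t\<in>{1..<p}. ev f (z ^ t)) = of_int N"
proof -
  define F where "F = (\<Prod>t\<in>{1..<p}. pcompose f (monom 1 t))"
  have F: "ev F w = (\<Prod>t\<in>{1..<p}. ev f (w ^ t))" for w
    by (simp add: F_def)
  have inv: "ev F (z ^ s) = ev F z" if "s \<in> {1..<p}" for s
  proof -
    have "ev F (z ^ s) = (\<Prod>t\<in>{1..<p}. ev f (z ^ (s * t mod p)))"
      by (simp add: F power_mod_exponent[OF z_power] power_mult)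
    also have "\<dots> = (\<Prod>t\<in>{1..<p}. ev f (z ^ t))"
      using prod.reindex_bij_betw[OF bij_betw_mult_mod_prime[OF p_prime not_dvd_range[OF that]], of "\<lambda>t. ev f (z ^ t)"] .
    finally show ?thesis by (simp add: F)
  qed
  obtain q r where qr: "F = cyclotomic_prime p * q + r" "degree r < degree (cyclotomic_prime p)"
    using p_gt_1 monic_division[of "cyclotomic_prime p" F]
    by (auto simp: coeff_cyclotomic_prime degree_cyclotomic_prime)
  have deg: "degree r < p - 1" using qr(2) by (simp add: degree_cyclotomic_prime)
  have r: "ev r (z ^ s) = ev F z" if "s \<in> {1..<p}" for s
  proof -
    have "ev (cyclotomic_prime p) (z ^ s) = 0"
      by (rule ev_cyclotomic_prime) (auto simp: z_power_neq_1 not_dvd_range[OF that])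
    then have "ev F (z ^ s) = ev r (z ^ s)" by (simp add: qr(1))
    then show ?thesis using inv[OF that] by simp
  qed
  \<comment> \<open>The sum of \<open>r\<close> over all \<open>p\<close>-th roots of unity is
    \<open>p * coeff r 0\<close> by orthogonality. Removing the value at 1 leaves the trace.\<close>
  define n where "n = int p * coeff r 0 - poly r 1"
  have "(\<Sum>s<p. ev r (z ^ s)) = (\<Sum>s<p. \<Sum>i<p. of_int (coeff r i) * (z ^ i) ^ s)"
    using deg by (intro sum.cong refl, subst ev_eq_sum_less[of _ p]) (auto simp: mult.commute simp flip: power_mult)
  also have "\<dots> = (\<Sum>i<p. of_int (coeff r i) * ev (cyclotomic_prime p) (z ^ i))"
    by (subst sum.swap) (simp add: cyclotomic_prime_def sum_distrib_left)
  also have "\<dots> = (\<Sum>i<p. if i = 0 then of_int (coeff r i) * of_nat p else 0)"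
  proof (intro sum.cong refl)
    fix i assume "i \<in> {..<p}"
    then show "of_int (coeff r i) * ev (cyclotomic_prime p) (z ^ i)
        = (if i = 0 then of_int (coeff r i) * of_nat p else 0)"
      using ev_at_int[of "cyclotomic_prime p" 1] poly_cyclotomic_prime_1[of p]
      by (cases "i = 0") (auto simp: z_power_neq_1 not_dvd_range intro!: ev_cyclotomic_prime)
  qed
  also have "\<dots> = of_int (int p * coeff r 0)" by simp
  finally have "of_int (int p * coeff r 0) = (\<Sum>s<p. ev r (z ^ s))" by simp
  also have "{..<p} = insert 0 {1..<p}" by auto
  also have "(\<Sum>s\<in>\<dots>. ev r (z ^ s)) = of_int (poly r 1) + (\<Sum>s\<in>{1..<p}. ev r (z ^ s))"
    using ev_at_int[of r 1] by simp
  also have "(\<Sum>s\<in>{1..<p}. ev r (z ^ s)) = of_nat (p - 1) * ev F z"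
    using r by simp
  also have "ev F z = ev r z" using r[of 1] p_gt_1 by simp
  finally have "ev (smult (int (p - 1)) r - [:n:]) z = 0"
    by (simp add: n_def)
  moreover have "degree (smult (int (p - 1)) r - [:n:]) < p - 1"
    using deg by (intro degree_diff_less) auto
  ultimately have eq: "smult (int (p - 1)) r - [:n:] = 0"
    using cyclotomic_prime_minimal[OF p_prime z_power z_neq_1] by blast
  have "degree (smult (int (p - 1)) r) = 0"
    using eq by (metis degree_pCons_0 eq_iff_diff_eq_0)
  then have "degree r = 0" using p_gt_1 by simp
  then obtain c where "r = [:c:]" by (auto elim: degree_eq_zeroE)
  then have "ev F z = of_int c" using r[of 1] p_gt_1 by simp
  then show ?thesis using that F by simp
qed

end

section \<open>Congruences at the prime above p\<close>

context prime_cyclotomic begin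

text \<open>Congruence modulo a principal ideal, expressed by elements. Membership of
  \<open>x\<close> and \<open>y\<close> in \<open>R\<close> is not included and is therefore asked
  for in the rules for products.\<close>

definition congR :: "complex \<Rightarrow> complex \<Rightarrow> complex \<Rightarrow> bool" where
  "congR m x y \<longleftrightarrow> (\<exists>c\<in>R. x - y = m * c)"

lemma congR_refl [simp, intro]: "congR m x x"
  unfolding congR_def by (rule bexI[of _ 0]) auto

lemma congR_sym: "congR m x y \<Longrightarrow> congR m y x"
  unfolding congR_def
proof safe
  fix c assume "c \<in> R" "x - y = m * c"
  then show "\<exists>c\<in>R. y - x = m * c" by (intro bexI[of _ "- c"]) (auto simp: algebra_simps)
qed

lemma congR_trans [trans]:
  assumes "congR m x y" "congR m y w"
  shows "congR m x w"
proof -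
  obtain c d where "c \<in> R" "x - y = m * c" "d \<in> R" "y - w = m * d"
    using assms by (auto simp: congR_def)
  then show ?thesis unfolding congR_def
    by (intro bexI[of _ "c + d"]) (auto simp: algebra_simps)
qed

lemma congR_add:
  assumes "congR m x y" "congR m x' y'"
  shows "congR m (x + x') (y + y')"
proof -
  obtain c d where "c \<in> R" "x - y = m * c" "d \<in> R" "x' - y' = m * d"
    using assms by (auto simp: congR_def)
  then show ?thesis unfolding congR_def
    by (intro bexI[of _ "c + d"]) (auto simp: algebra_simps)
qed

lemma congR_mult:
  assumes "congR m x y" "congR m x' y'" "x' \<in> R" "y \<in> R"
  shows "congR m (x * x') (y * y')"
proof -
  obtain c d where *: "c \<in> R" "x - y = m * c" "d \<in> R" "x' - y' = m * d"
    using assms by (auto simp: congR_def)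
  have "x * x' - y * y' = (x - y) * x' + y * (x' - y')" by (simp add: algebra_simps)
  also have "\<dots> = m * (c * x' + y * d)" using * by (simp add: algebra_simps)
  finally show ?thesis unfolding congR_def using * assms by auto
qed

lemma congR_power:
  assumes "congR m x y" "x \<in> R" "y \<in> R"
  shows "congR m (x ^ n) (y ^ n)"
  using assms by (induction n) (auto intro!: congR_mult)

lemma congR_prod:
  assumes "\<And>i. i \<in> S \<Longrightarrow> congR m (f i) (g i)" "\<And>i. i \<in> S \<Longrightarrow> f i \<in> R" "\<And>i. i \<in> S \<Longrightarrow> g i \<in> R"
  shows "congR m (prod f S) (prod g S)"
  using assms by (induction S rule: infinite_finite_induct) (auto intro!: congR_mult)

text \<open>Since \<open>z\<close> is 1 modulo \<open>lam\<close>, reduction modulo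
  \<open>lam\<close> is evaluation at 1.\<close>

lemma ev_congR_lam: "congR lam (ev f z) (of_int (poly f 1))"
proof (induction f)
  case (pCons a f)
  then obtain c where c: "c \<in> R" "ev f z - of_int (poly f 1) = lam * c" by (auto simp: congR_def)
  have "ev (pCons a f) z - of_int (poly (pCons a f) 1) = lam * ev f z + (ev f z - of_int (poly f 1))"
    by (simp add: algebra_simps)
  also have "\<dots> = lam * (ev f z + c)" using c(2) by (simp only: distrib_left)
  finally show ?case using c unfolding congR_def by auto
qed simp

text \<open>The cyclotomic polynomial has the value 0 at \<open>z\<close> and the value
  \<open>p\<close> at 1.\<close>

lemma p_multiple_of_lam: obtains c where "c \<in> R" "of_nat p = lam * c"
proof -
  have "congR lam (ev (cyclotomic_prime p) z) (of_int (int p))"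
    using ev_congR_lam[of "cyclotomic_prime p"] by (simp only: poly_cyclotomic_prime_1)
  then have "congR lam (of_nat p) 0"
    using congR_sym by (simp add: ev_cyclotomic_prime[OF z_power z_neq_1])
  then show ?thesis using that by (auto simp: congR_def)
qed

text \<open>If \<open>lam * f(z) = 1\<close>, the cyclotomic polynomial divides
  \<open>(x - 1) * f - 1\<close>, and evaluation at 1 gives \<open>p dvd 1\<close>.\<close>

lemma lam_not_unit: "c \<in> R \<Longrightarrow> lam * c \<noteq> 1"
proof
  assume "c \<in> R" "lam * c = 1"
  then obtain f where "lam * ev f z = 1" by (auto simp: cyc_int_iff)
  then have "ev ([:-1, 1:] * f - 1) z = 0"
    by (simp only: ev_diff ev_mult) (simp add: algebra_simps)
  then have "cyclotomic_prime p dvd [:-1, 1:] * f - 1"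
    by (rule cyclotomic_prime_dvd[OF p_prime z_power z_neq_1])
  then obtain h where "[:-1, 1:] * f - 1 = cyclotomic_prime p * h" ..
  then have "poly ([:-1, 1:] * f - 1) 1 = int p * poly h 1"
    by (simp only: poly_mult poly_cyclotomic_prime_1)
  then have "int p dvd 1" by (simp add: dvd_def) (metis add.inverse_inverse mult_minus_right)
  then show False using p_gt_1 by simp
qed

text \<open>The middle binomial coefficients are divisible by \<open>p\<close>. Separating the
  linear term shows that all of them together contribute \<open>p * x\<close> times a factor that is
  1 modulo \<open>x\<close>.\<close>

lemma binomial_prime_expansion:
  assumes "x \<in> R"
  obtains y where "y \<in> R" "(1 + x) ^ p = 1 + of_nat p * x * (1 + x * y) + x ^ p"
proof -
  define y where "y = (\<Sum>i\<in>{2..<p}. of_nat ((p choose i) div p) * x ^ (i - 2))"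
  have "(1 + x) ^ p = (\<Sum>i\<le>p. of_nat (p choose i) * x ^ i)"
    using binomial_ring[of x 1 p] by (simp add: add.commute)
  also have "{..p} = insert p (insert 0 (insert 1 {2..<p}))"
    using p_gt_1 by auto
  also have "(\<Sum>i\<in>\<dots>. of_nat (p choose i) * x ^ i)
      = x ^ p + (1 + (of_nat p * x + (\<Sum>i\<in>{2..<p}. of_nat (p choose i) * x ^ i)))"
    using p_gt_1 by simp
  also have "(\<Sum>i\<in>{2..<p}. of_nat (p choose i) * x ^ i) = of_nat p * x\<^sup>2 * y"
    unfolding y_def sum_distrib_left
  proof (intro sum.cong refl)
    fix i assume i: "i \<in> {2..<p}"
    then have "p dvd p choose i" using p_prime by (intro dvd_choose_prime) auto
    then have "of_nat (p choose i) = of_nat p * (of_nat ((p choose i) div p) :: complex)"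
      by (metis dvd_mult_div_cancel of_nat_mult)
    moreover have "x ^ i = x\<^sup>2 * x ^ (i - 2)" using i by (metis atLeastLessThan_iff le_add_diff_inverse power_add)
    ultimately show "of_nat (p choose i) * x ^ i
        = of_nat p * x\<^sup>2 * (of_nat ((p choose i) div p) * x ^ (i - 2))" by simp
  qed
  finally have "(1 + x) ^ p = 1 + of_nat p * x * (1 + x * y) + x ^ p"
    by (simp add: algebra_simps power2_eq_square)
  moreover have "y \<in> R" using assms by (auto simp: y_def)
  ultimately show ?thesis using that by blast
qed

lemma lam_power_p: obtains c where "c \<in> R" "lam ^ p = of_nat p * c"
proof -
  obtain y where y: "y \<in> R" "(1 + lam) ^ p = 1 + of_nat p * lam * (1 + lam * y) + lam ^ p"
    using binomial_prime_expansion[of lam] by auto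
  then have "lam ^ p = of_nat p * (- lam * (1 + lam * y))"
    using z_power by (simp add: algebra_simps)
  moreover have "- lam * (1 + lam * y) \<in> R" using y by auto
  ultimately show ?thesis using that by blast
qed

text \<open>The first \<open>p\<close>-th power turns \<open>1 + lam\<^sup>2 * c\<close> into
  \<open>1 + p * r\<close>, because \<open>p\<close> divides \<open>lam ^ p\<close>. The second
  turns this into 1 modulo \<open>p\<^sup>2\<close>.\<close>

lemma power_p2_cong_1:
  assumes "w \<in> R" "congR (lam\<^sup>2) w 1"
  shows "congR (of_nat (p\<^sup>2)) (w ^ p\<^sup>2) 1"
proof -
  obtain c where c: "c \<in> R" "w - 1 = lam\<^sup>2 * c" using assms by (auto simp: congR_def)
  obtain d where d: "d \<in> R" "lam ^ p = of_nat p * d" by (rule lam_power_p)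
  have c1: "lam\<^sup>2 * c \<in> R" using c by auto
  obtain y where y: "y \<in> R"
      "(1 + lam\<^sup>2 * c) ^ p = 1 + of_nat p * (lam\<^sup>2 * c) * (1 + lam\<^sup>2 * c * y) + (lam\<^sup>2 * c) ^ p"
    by (rule binomial_prime_expansion[OF c1])
  define r where "r = (lam\<^sup>2 * c) * (1 + lam\<^sup>2 * c * y) + d * lam ^ p * c ^ p"
  have "(lam\<^sup>2 * c) ^ p = of_nat p * (d * lam ^ p * c ^ p)"
    using d by (simp add: power_mult_distrib power_mult[symmetric] mult.commute[of 2]) 
      (simp add: power_mult power2_eq_square)
  then have wp: "w ^ p = 1 + of_nat p * r"
    using y c by (simp add: r_def algebra_simps)
  have r: "r \<in> R" using c d y by (auto simp: r_def)
  then have pr: "of_nat p * r \<in> R" by auto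
  obtain y' where y': "y' \<in> R"
      "(1 + of_nat p * r) ^ p = 1 + of_nat p * (of_nat p * r) * (1 + of_nat p * r * y') + (of_nat p * r) ^ p"
    by (rule binomial_prime_expansion[OF pr])
  have "p = 2 + (p - 2)" using p_ge_3 by simp
  then have "(of_nat p :: complex) ^ p = of_nat p ^ 2 * of_nat p ^ (p - 2)"
    by (metis power_add)
  then have "(1 + of_nat p * r) ^ p - 1
      = of_nat (p\<^sup>2) * (r * (1 + of_nat p * r * y') + of_nat p ^ (p - 2) * r ^ p)"
    unfolding y'(2) by (simp add: power_mult_distrib algebra_simps power2_eq_square)
  moreover have "w ^ p\<^sup>2 = (1 + of_nat p * r) ^ p"
    by (simp add: power2_eq_square power_mult wp)
  moreover have "r * (1 + of_nat p * r * y') + of_nat p ^ (p - 2) * r ^ p \<in> R"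
    using r y' by auto
  ultimately show ?thesis unfolding congR_def by auto
qed

text \<open>For \<open>w = 1 + x\<close> with \<open>x\<close> nonzero, \<open>w ^ p = 1\<close>
  becomes \<open>p * (1 + x * y) + x ^ (p - 1) = 0\<close>. Here \<open>x ^ (p - 1)\<close> is
  divisible by \<open>p * lam\<close>; cancelling \<open>p\<close> makes \<open>lam\<close> a
  unit.\<close>

lemma p_torsion_trivial:
  assumes "w \<in> R" "congR (lam\<^sup>2) w 1" "w ^ p = 1"
  shows "w = 1"
proof (rule ccontr)
  assume "w \<noteq> 1"
  obtain c where c: "c \<in> R" "w - 1 = lam\<^sup>2 * c" using assms by (auto simp: congR_def)
  define x where "x = lam\<^sup>2 * c"
  have x: "x \<in> R" "w = 1 + x" "x \<noteq> 0" using c \<open>w \<noteq> 1\<close> by (auto simp: x_def algebra_simps)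
  obtain d where d: "d \<in> R" "lam ^ p = of_nat p * d" by (rule lam_power_p)
  obtain y where y: "y \<in> R" "(1 + x) ^ p = 1 + of_nat p * x * (1 + x * y) + x ^ p"
    by (rule binomial_prime_expansion[OF x(1)])
  have "x ^ p = x * x ^ (p - 1)" using p_ge_3 by (simp add: power_eq_if)
  then have "x * (of_nat p * (1 + x * y) + x ^ (p - 1)) = 0"
    using y(2) x(2) assms(3) by (simp add: algebra_simps)
  then have eq: "of_nat p * (1 + x * y) + x ^ (p - 1) = 0" using x by simp
  \<comment> \<open>The exponent of \<open>lam\<close> in \<open>x ^ (p - 1)\<close> is split into
    \<open>p\<close>, which yields the factor \<open>p\<close>, one further \<open>lam\<close>, and
    a rest.\<close>
  have "2 * (p - 1) = p + (1 + (p - 3))" using p_ge_3 by simp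
  then have "x ^ (p - 1) = lam ^ (p + (1 + (p - 3))) * c ^ (p - 1)"
    unfolding x_def power_mult_distrib power_mult[symmetric] by simp
  then have "x ^ (p - 1) = of_nat p * (lam * (d * lam ^ (p - 3) * c ^ (p - 1)))"
    by (simp add: power_add d)
  then have "of_nat p * (1 + x * y + lam * (d * lam ^ (p - 3) * c ^ (p - 1))) = 0"
    using eq by (simp only: distrib_left add.assoc)
  then have "1 + x * y + lam * (d * lam ^ (p - 3) * c ^ (p - 1)) = 0" by simp
  then have "lam * (- (lam * c * y + d * lam ^ (p - 3) * c ^ (p - 1))) = 1"
    by (simp add: x_def algebra_simps power2_eq_square add_eq_0_iff2)
  moreover have "- (lam * c * y + d * lam ^ (p - 3) * c ^ (p - 1)) \<in> R"
    using c d y by auto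
  ultimately show False using lam_not_unit by blast
qed

text \<open>The norm is an integer of absolute value below 1, hence 0, so some conjugate
  vanishes.\<close>

lemma eq_0_if_conjugates_small:
  assumes "\<And>t. t \<in> {1..<p} \<Longrightarrow> norm (ev f (z ^ t)) < 1"
  shows "ev f z = 0"
proof -
  obtain N where N: "(\<Prod>t\<in>{1..<p}. ev f (z ^ t)) = of_int N" by (rule norm_is_int)
  have "norm (\<Prod>t\<in>{1..<p}. ev f (z ^ t)) < 1"
  proof -
    have "(\<Prod>t\<in>{1..<p}. norm (ev f (z ^ t))) < (\<Prod>t\<in>{1..<p}. 1)"
      using assms assms[of 1] p_gt_1 by (intro prod_mono_strict[of 1]) (auto intro: less_imp_le)
    then show ?thesis by (simp add: prod_norm)
  qed
  then have "N = 0" unfolding N by simp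
  then obtain t where "t \<in> {1..<p}" "ev f (z ^ t) = 0"
    using N by auto
  then show ?thesis using ev_eq_0_conj not_dvd_range by blast
qed

text \<open>The number \<open>(w ^ p\<^sup>2 - 1) / p\<^sup>2\<close> is integral and its conjugates
  have absolute value at most \<open>2 / p\<^sup>2\<close>, so it is 0. Absence of
  \<open>p\<close>-torsion is then used twice.\<close>

lemma unit_circle_cong_1:
  assumes "w \<in> R" "congR (lam\<^sup>2) w 1" "norm w = 1"
    shows "w = 1"
proof -
  obtain f where f: "w = ev f z" using assms by (auto simp: cyc_int_iff)
  have "congR (of_nat (p\<^sup>2)) (w ^ p\<^sup>2) 1" using assms by (intro power_p2_cong_1) auto
  then obtain h where h: "w ^ p\<^sup>2 - 1 = of_nat (p\<^sup>2) * ev h z"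
    unfolding congR_def by (metis cyc_int_iff)
  have "ev h z = 0"
  proof (rule eq_0_if_conjugates_small)
    fix t assume t: "t \<in> {1..<p}"
    \<comment> \<open>As \<open>cnj w\<close> is the value of \<open>f\<close> at
      \<open>z ^ (p - 1)\<close>, the equation \<open>w * cnj w = 1\<close> is one between
      polynomial values, and it passes to all conjugates.\<close>
    have "ev (f * pcompose f (monom 1 (p - 1))) z = w * cnj w"
      using cnj_ev_z[of 1 f] p_gt_1 f by simp
    also have "\<dots> = 1" using assms(3) by (simp flip: complex_norm_square)
    finally have "ev (f * pcompose f (monom 1 (p - 1))) (z ^ t) = ev 1 (z ^ t)"
      using not_dvd_range[OF t] by (intro ev_eq_conj) auto
    then have "ev f (z ^ t) * ev f (z ^ (t * (p - 1))) = 1" by (simp add: power_mult)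
    moreover have "z ^ (t * (p - 1)) = z ^ (p - t)"
    proof (rule power_root_cong[OF z_power])
      have "t * (p - 1) + t = t * p" using p_gt_1 by (simp add: algebra_simps)
      then have "[t * (p - 1) + t = (p - t) + t] (mod p)" using t by (simp add: cong_def)
      then show "[t * (p - 1) = p - t] (mod p)" by (simp only: cong_add_rcancel_nat)
    qed
    ultimately have "ev f (z ^ t) * cnj (ev f (z ^ t)) = 1"
      using cnj_ev_z[of t f] t by simp
    then have n1: "norm (ev f (z ^ t)) = 1"
      by (metis complex_mod_sqrt_Re_mult_cnj one_complex.sel(1) real_sqrt_one)
    have "ev (f ^ p\<^sup>2 - 1) z = ev (of_nat (p\<^sup>2) * h) z"
      using h f by (simp only: ev_diff ev_power ev_mult ev_of_nat ev_1)
    then have "ev (f ^ p\<^sup>2 - 1) (z ^ t) = ev (of_nat (p\<^sup>2) * h) (z ^ t)"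
      using not_dvd_range[OF t] by (rule ev_eq_conj)
    then have "of_nat (p\<^sup>2) * ev h (z ^ t) = ev f (z ^ t) ^ p\<^sup>2 - 1"
      by (simp only: ev_diff ev_power ev_mult ev_of_nat ev_1)
    then have "real (p\<^sup>2) * norm (ev h (z ^ t)) = norm (ev f (z ^ t) ^ p\<^sup>2 - 1)"
      by (metis norm_mult norm_of_nat)
    also have "\<dots> \<le> 2"
      using norm_triangle_ineq4[of "ev f (z ^ t) ^ p\<^sup>2" 1] by (simp add: norm_power n1)
    finally have le: "real (p\<^sup>2) * norm (ev h (z ^ t)) \<le> 2" .
    have "9 \<le> p\<^sup>2" using power_mono[OF p_ge_3, of 2] by simp
    then have "real 9 \<le> real (p\<^sup>2)" by (simp only: of_nat_le_iff)
    then have "real (p\<^sup>2) \<ge> 9" by (simp only: of_nat_numeral)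
    then have "9 * norm (ev h (z ^ t)) \<le> real (p\<^sup>2) * norm (ev h (z ^ t))"
      by (rule mult_right_mono) simp
    then show "norm (ev h (z ^ t)) < 1" using le by simp
  qed
  then have "w ^ p\<^sup>2 = 1" using h by simp
  then have "(w ^ p) ^ p = 1" by (simp add: power2_eq_square power_mult)
  moreover have "congR (lam\<^sup>2) (w ^ p) (1 ^ p)" using assms by (intro congR_power) auto
  ultimately have "w ^ p = 1"
    using p_torsion_trivial[of "w ^ p"] assms(1) by simp
  then show ?thesis using p_torsion_trivial assms by blast
qed

end

section \<open>Localisation at a totally split prime\<close>

lemma cong_poly:
  fixes f :: "int poly"
  assumes "[x = y] (mod m)"
  shows "[poly f x = poly f y] (mod m)"
  by (induction f) (auto intro!: cong_add cong_mult assms)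

text \<open>The integer \<open>k\<close> is the image of zeta in the completion at a degree-one
  prime above \<open>l\<close>, known to precision \<open>l ^ M\<close>. Evaluation at
  \<open>k ^ t\<close> gives the image of a conjugate.\<close>

locale split_prime = prime_cyclotomic +
  fixes l M k :: nat
  assumes l_prime: "prime l" and M_pos: "M > 0"
    and k_root: "[k ^ p = 1] (mod l ^ M)" and k_neq_1: "[k \<noteq> 1] (mod l)"
begin

lemma k_root_mod_l: "[k ^ p = 1] (mod l)"
  using k_root M_pos cong_dvd_modulus_nat dvd_power by blast

lemma coprime_k: "coprime l k"
proof -
  have "\<not> l dvd k"
  proof
    assume "l dvd k"
    then have "[k ^ p = 0] (mod l)" by (meson cong_0_iff dvd_power dvd_trans p_gt_0)
    then have "[1 = 0] (mod l)" using k_root_mod_l cong_sym cong_trans by blast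
    then show False using l_prime by (simp add: cong_0_iff)
  qed
  then show ?thesis using l_prime prime_imp_coprime by blast
qed

lemma ord_k: "ord l k = p"
proof -
  have "ord l k dvd p" using k_root_mod_l ord_divides by blast
  moreover have "ord l k \<noteq> 1"
    using k_neq_1 ord_works[of k l] by auto
  ultimately show ?thesis using p_prime by (auto simp: prime_nat_iff)
qed

lemma k_power_cong_iff: "[k ^ a = k ^ b] (mod l) \<longleftrightarrow> [a = b] (mod p)"
  using order_divides_expdiff[OF coprime_k] ord_k by simp

lemma p_dvd_l_minus_1: "p dvd l - 1"
  using order_divides_totient[of l k] coprime_k ord_k l_prime by (simp add: totient_prime)

lemma l_gt_p: "l > p"
  using p_dvd_l_minus_1 prime_gt_1_nat[OF l_prime] by (auto dest: dvd_imp_le)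

lemma int_k_power_minus_1: "\<not> p dvd t \<Longrightarrow> coprime (int k ^ t - 1) (int l)"
proof -
  assume "\<not> p dvd t"
  then have "\<not> [k ^ t = k ^ 0] (mod l)" unfolding k_power_cong_iff by (simp add: cong_0_iff)
  then have "\<not> [int k ^ t = 1] (mod int l)"
    using cong_int_iff[of "k ^ t" 1 l] by simp
  then have "\<not> int l dvd int k ^ t - 1" by (simp add: cong_iff_dvd_diff)
  then show ?thesis
    using l_prime by (metis coprime_commute prime_imp_coprime prime_nat_int_transfer)
qed

lemma int_k_power_root: "[(int k ^ t) ^ p = 1] (mod int l ^ M)"
proof -
  have "[int (k ^ p) = int 1] (mod int (l ^ M))" using k_root by (simp only: cong_int_iff)
  then have "[(int k ^ p) ^ t = 1 ^ t] (mod int l ^ M)" by (intro cong_pow) simp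
  then show ?thesis by (simp add: mult.commute flip: power_mult)
qed

text \<open>The factor \<open>k ^ t - 1\<close> of \<open>(k ^ t) ^ p - 1\<close> is prime to
  \<open>l\<close>, so \<open>l ^ M\<close> divides the cofactor.\<close>

lemma cyclotomic_at_k: "\<not> p dvd t \<Longrightarrow> int l ^ M dvd poly (cyclotomic_prime p) (int k ^ t)"
proof -
  assume t: "\<not> p dvd t"
  have "int l ^ M dvd (int k ^ t) ^ p - 1"
    using int_k_power_root[of t] by (simp add: cong_iff_dvd_diff)
  then have "int l ^ M dvd (int k ^ t - 1) * poly (cyclotomic_prime p) (int k ^ t)"
    by (simp only: poly_cyclotomic_prime_mult)
  moreover have "coprime (int l ^ M) (int k ^ t - 1)"
    using int_k_power_minus_1[OF t] by (simp add: coprime_commute)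
  ultimately show ?thesis by (simp add: coprime_dvd_mult_right_iff)
qed

text \<open>This makes evaluation at \<open>k ^ t\<close> a well-defined ring map from
  \<open>Z[zeta]\<close> to the integers modulo \<open>l ^ M\<close>.\<close>

lemma poly_cong_at_k:
  assumes "ev f z = ev g z" "\<not> p dvd t"
  shows "[poly f (int k ^ t) = poly g (int k ^ t)] (mod int l ^ M)"
proof -
  have "cyclotomic_prime p dvd f - g"
    using assms by (intro cyclotomic_prime_dvd[OF p_prime z_power z_neq_1]) auto
  then obtain h where "f - g = cyclotomic_prime p * h" ..
  then have "poly f (int k ^ t) - poly g (int k ^ t) = poly (cyclotomic_prime p) (int k ^ t) * poly h (int k ^ t)"
    by (metis poly_diff poly_mult)
  then show ?thesis
    using cyclotomic_at_k[OF assms(2)] by (simp add: cong_iff_dvd_diff)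
qed

lemma poly_cong_exponent:
  assumes "[a = b] (mod p)"
  shows "[poly f (int k ^ a) = poly f (int k ^ b)] (mod int l ^ M)"
proof -
  have *: "[int k ^ a = int k ^ (a mod p)] (mod int l ^ M)" for a
  proof -
    have "[(int k ^ p) ^ (a div p) = 1 ^ (a div p)] (mod int l ^ M)"
      using int_k_power_root[of 1] by (intro cong_pow) simp
    then have "[(int k ^ p) ^ (a div p) * int k ^ (a mod p) = 1 * int k ^ (a mod p)] (mod int l ^ M)"
      by (intro cong_mult) auto
    then show ?thesis by (simp flip: power_mult power_add)
  qed
  have "[int k ^ a = int k ^ b] (mod int l ^ M)"
    using *[of a] *[of b] assms by (metis cong_def)
  then show ?thesis
    by (rule cong_poly)
qed

text \<open>The inverse discrete Fourier transform at the powers of \<open>k\<close> recovers the coefficients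
  modulo \<open>l ^ M\<close>, up to a common additive constant.\<close>

lemma divisible_if_conjugates_divisible:
  assumes "\<And>t. t \<in> {1..<p} \<Longrightarrow> int l ^ M dvd poly f (int k ^ t)"
  obtains h where "ev f z = of_nat (l ^ M) * ev h z"
proof -
  obtain c q where c: "\<And>w. w ^ p = 1 \<Longrightarrow> ev f w = (\<Sum>i<p. of_int (c i) * w ^ i)"
    and q: "\<And>x. poly f x = (\<Sum>i<p. c i * x ^ i) + (x ^ p - 1) * poly q x"
    using reduce_mod_power_minus_1[of p f] by (metis p_gt_0)
  define L where "L = int l ^ M"
  define C where "C = (\<lambda>t. \<Sum>i<p. c i * (int k ^ t) ^ i)"
  have C: "L dvd C t" if "t \<in> {1..<p}" for t
  proof -
    have "L dvd ((int k ^ t) ^ p - 1) * poly q (int k ^ t)"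
      using int_k_power_root[of t] by (auto simp: cong_iff_dvd_diff L_def)
    moreover have "L dvd poly f (int k ^ t)" using assms[OF that] by (simp add: L_def)
    ultimately show ?thesis unfolding q C_def
      by (simp add: dvd_add_left_iff)
  qed
  have "[int p * c j = C 0] (mod L)" if j: "j < p" for j
  proof -
    \<comment> \<open>The weight \<open>(k ^ t) ^ (p - j)\<close> stands for
      \<open>k ^ (- t * j)\<close> and isolates the coefficient with index \<open>j\<close>.\<close>
    have "(\<Sum>t<p. (int k ^ t) ^ (p - j) * C t)
        = (\<Sum>t<p. \<Sum>i<p. c i * (int k ^ (i + (p - j))) ^ t)"
      unfolding C_def sum_distrib_left
      by (intro sum.cong refl) (simp add: algebra_simps flip: power_mult power_add)
    also have "\<dots> = (\<Sum>i<p. c i * poly (cyclotomic_prime p) (int k ^ (i + (p - j))))"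
      by (subst sum.swap) (simp add: cyclotomic_prime_def poly_sum poly_monom sum_distrib_left)
    finally have *: "(\<Sum>t<p. (int k ^ t) ^ (p - j) * C t)
        = (\<Sum>i<p. c i * poly (cyclotomic_prime p) (int k ^ (i + (p - j))))" .
    have "[(\<Sum>i<p. c i * poly (cyclotomic_prime p) (int k ^ (i + (p - j))))
        = (\<Sum>i<p. if i = j then c i * int p else 0)] (mod L)"
    proof (rule cong_sum)
      fix i assume i: "i \<in> {..<p}"
      show "[c i * poly (cyclotomic_prime p) (int k ^ (i + (p - j)))
          = (if i = j then c i * int p else 0)] (mod L)"
      proof (cases "i = j")
        case True
        then have "[poly (cyclotomic_prime p) (int k ^ (i + (p - j)))
            = poly (cyclotomic_prime p) (int k ^ 0)] (mod L)"
          unfolding L_def using j by (intro poly_cong_exponent) (auto simp: cong_0_iff)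
        then have "[poly (cyclotomic_prime p) (int k ^ (i + (p - j))) = int p] (mod L)"
          by (simp add: poly_cyclotomic_prime_1)
        then show ?thesis using True by (simp add: cong_mult)
      next
        case False
        have "\<not> p dvd i + (p - j)"
        proof
          assume "p dvd i + (p - j)"
          then obtain r where r: "i + (p - j) = p * r" ..
          have "0 < p * r" "p * r < p * 2" using i j unfolding r[symmetric] by auto
          then have "r = 1" by (cases r) auto
          then show False using r j False by simp
        qed
        then have "L dvd poly (cyclotomic_prime p) (int k ^ (i + (p - j)))"
          unfolding L_def by (rule cyclotomic_at_k)
        then show ?thesis using False by (simp add: cong_0_iff)
      qed
    qed
    also have "(\<Sum>i<p. if i = j then c i * int p else 0) = int p * c j"
      using j by simp
    finally have 1: "[(\<Sum>t<p. (int k ^ t) ^ (p - j) * C t) = int p * c j] (mod L)"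
      unfolding * .
    have "{..<p} = insert 0 {1..<p}" by auto
    then have "(\<Sum>t<p. (int k ^ t) ^ (p - j) * C t) = C 0 + (\<Sum>t\<in>{1..<p}. (int k ^ t) ^ (p - j) * C t)"
      by simp
    moreover have "L dvd (\<Sum>t\<in>{1..<p}. (int k ^ t) ^ (p - j) * C t)"
      using C by (intro dvd_sum dvd_mult) auto
    ultimately have "[(\<Sum>t<p. (int k ^ t) ^ (p - j) * C t) = C 0] (mod L)"
      by (simp add: cong_iff_dvd_diff)
    then show ?thesis using 1 cong_sym cong_trans by blast
  qed
  then have "[int p * c j = int p * c 0] (mod L)" if "j < p" for j
    using that cong_sym cong_trans p_gt_0 by blast
  \<comment> \<open>The factor \<open>p\<close> of the inverse transform can be cancelled because
    \<open>l > p\<close>.\<close>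
  moreover have "coprime (int p) L"
    using l_prime p_prime l_gt_p by (simp add: L_def primes_coprime)
  ultimately have "[c j = c 0] (mod L)" if "j < p" for j
    using that cong_mult_lcancel by blast
  then have dv: "L dvd c j - c 0" if "j < p" for j
    using that by (simp add: cong_iff_dvd_diff)
  define d where "d = (\<lambda>j. (c j - c 0) div L)"
  have d: "c j = c 0 + L * d j" if "j < p" for j
    using dv[OF that] by (simp add: d_def)
  \<comment> \<open>The common constant \<open>c 0\<close> disappears, since the powers of
    \<open>z\<close> sum to 0.\<close>
  have "ev f z = (\<Sum>i<p. of_int (c 0 + L * d i) * z ^ i)"
    unfolding c[OF z_power] by (intro sum.cong refl, subst d) auto
  also have "\<dots> = of_int (c 0) * (\<Sum>i<p. z ^ i) + of_int L * (\<Sum>i<p. of_int (d i) * z ^ i)"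
    by (simp add: sum.distrib sum_distrib_left algebra_simps)
  also have "(\<Sum>i<p. z ^ i) = 0"
    using ev_cyclotomic_prime[OF z_power z_neq_1] by (simp add: cyclotomic_prime_def)
  also have "(\<Sum>i<p. of_int (d i) * z ^ i) = ev (\<Sum>i<p. monom (d i) i) z" by simp
  finally have "ev f z = of_nat (l ^ M) * ev (\<Sum>i<p. monom (d i) i) z" by (simp add: L_def)
  then show ?thesis by (rule that)
qed

end

section \<open>Gauss and Jacobi sums\<close>

text \<open>As \<open>x ^ d = 1\<close> has at most \<open>d\<close> roots modulo \<open>l\<close>,
  some \<open>c\<close> has \<open>c ^ d\<close> different from 1. Replacing \<open>x\<close> by
  \<open>c * x\<close> multiplies the sum by \<open>c ^ d\<close>, so it vanishes. For
  \<open>d = 0\<close> the sum is \<open>l\<close>, with \<open>0 ^ 0 = 1\<close>.\<close>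

lemma sum_powers_mod_prime:
  fixes l d :: nat
  assumes l: "prime l" and d: "d < l - 1"
  shows "l dvd (\<Sum>x<l. x ^ d)"
proof (cases "d = 0")
  case False
  have "\<exists>c\<in>{1..<l}. \<not> [c ^ d = 1] (mod l)"
  proof (rule ccontr)
    assume "\<not> ?thesis"
    then have "{1..<l} \<subseteq> {x\<in>{..<l}. [x ^ d = 1] (mod l)}" by auto
    then have "card {1..<l} \<le> card {x\<in>{..<l}. [x ^ d = 1] (mod l)}" by (intro card_mono) auto
    also have "\<dots> \<le> d" using roots_mod_prime_bound[OF l, of d 1] False by simp
    finally show False using d by simp
  qed
  then obtain c where c: "c \<in> {1..<l}" "\<not> [c ^ d = 1] (mod l)" by blast
  then have "\<not> l dvd c" by (auto dest: dvd_imp_le)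
  define S where "S = (\<Sum>x\<in>{1..<l}. x ^ d)"
  have "S = (\<Sum>x\<in>{1..<l}. (c * x mod l) ^ d)"
    unfolding S_def
    using sum.reindex_bij_betw[OF bij_betw_mult_mod_prime[OF l \<open>\<not> l dvd c\<close>], of "\<lambda>x. x ^ d"] by simp
  also have "[\<dots> = (\<Sum>x\<in>{1..<l}. c ^ d * x ^ d)] (mod l)"
    by (intro cong_sum) (simp add: cong_def power_mod flip: power_mult_distrib)
  also have "(\<Sum>x\<in>{1..<l}. c ^ d * x ^ d) = c ^ d * S" by (simp add: S_def sum_distrib_left)
  finally have "[S = c ^ d * S] (mod l)" .
  then have "[int S = int c ^ d * int S] (mod int l)" by (metis cong_int_iff of_nat_mult of_nat_power)
  then have "int l dvd (int c ^ d - 1) * int S"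
    by (metis cong_iff_dvd_diff cong_sym left_diff_distrib mult_1)
  moreover have "\<not> int l dvd int c ^ d - 1"
    using c(2) by (metis cong_iff_dvd_diff cong_int_iff of_nat_1 of_nat_power)
  ultimately have "l dvd S" using l by (simp add: prime_dvd_mult_iff)
  moreover have "{..<l} = insert 0 {1..<l}" using l prime_gt_0_nat by auto
  ultimately show ?thesis using False by (simp add: S_def zero_power)
qed simp

text \<open>The binomial expansion of \<open>(x + 1) ^ n\<close> only produces power sums with
  exponent at most \<open>m + n\<close>.\<close>

lemma sum_jacobi_mod_prime:
  fixes l m n :: nat
  assumes "prime l" "m + n < l - 1"
  shows "l dvd (\<Sum>x<l. x ^ m * (x + 1) ^ n)"
proof -
  have "(\<Sum>x<l. x ^ m * (x + 1) ^ n) = (\<Sum>x<l. \<Sum>j\<le>n. (n choose j) * x ^ (m + j))"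
    by (intro sum.cong refl, subst binomial) (simp add: sum_distrib_left power_add algebra_simps)
  also have "\<dots> = (\<Sum>j\<le>n. (n choose j) * (\<Sum>x<l. x ^ (m + j)))"
    by (subst sum.swap) (simp add: sum_distrib_left)
  also have "l dvd \<dots>"
    using assms by (intro dvd_sum dvd_mult sum_powers_mod_prime) auto
  finally show ?thesis .
qed

context prime_cyclotomic begin

text \<open>Expanding \<open>(1 + lam) ^ p = 1\<close> and cancelling \<open>lam\<close> gives
  \<open>p * (1 + lam * y) = - lam ^ (p - 1)\<close>, where \<open>p - 1 \<ge> 2\<close>; the term
  \<open>p * lam * y\<close> contains a second \<open>lam\<close> through \<open>p\<close>.\<close>

lemma p_cong_0_lam2: "congR (lam\<^sup>2) (of_nat p) 0"
proof -
  obtain c where c: "c \<in> R" "of_nat p = lam * c" by (rule p_multiple_of_lam)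
  obtain y where y: "y \<in> R" "(1 + lam) ^ p = 1 + of_nat p * lam * (1 + lam * y) + lam ^ p"
    using binomial_prime_expansion[of lam] by auto
  have "lam ^ p = lam * lam ^ (p - 1)" by (simp add: power_eq_if)
  moreover have "of_nat p * lam * (1 + lam * y) + lam ^ p = 0"
    using y(2) z_power by simp
  ultimately have "lam * (of_nat p * (1 + lam * y) + lam ^ (p - 1)) = 0"
    by (simp only: distrib_left mult_ac)
  then have "of_nat p * (1 + lam * y) + lam ^ (p - 1) = 0" using z_neq_1 by simp
  moreover have "p - 1 = 2 + (p - 3)" using p_ge_3 by simp
  then have "lam ^ (p - 1) = lam\<^sup>2 * lam ^ (p - 3)" by (metis power_add)
  ultimately have "of_nat p * (1 + lam * y) + lam\<^sup>2 * lam ^ (p - 3) = 0" by simp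
  then have "of_nat p + lam\<^sup>2 * (c * y) + lam\<^sup>2 * lam ^ (p - 3) = 0"
    by (simp only: distrib_left c(2) power2_eq_square mult.assoc mult_1_right) (simp add: mult_ac)
  then have "of_nat p - 0 = lam\<^sup>2 * (- (c * y) - lam ^ (p - 3))"
    by (simp only: right_diff_distrib mult_minus_right) (metis add.assoc add_eq_0_iff2 diff_0_right minus_add_distrib uminus_add_conv_diff add.commute)
  moreover have "- (c * y) - lam ^ (p - 3) \<in> R" using c y by auto
  ultimately show ?thesis unfolding congR_def by blast
qed

lemma z_power_minus_1: "\<exists>c\<in>R. z ^ n - 1 = lam * c"
proof -
  have "congR lam (z ^ n) (1 ^ n)"
    by (rule congR_power) (auto simp: congR_def intro!: bexI[of _ 1])
  then show ?thesis by (simp add: congR_def)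
qed

end

section \<open>Characters modulo \<open>l\<close> of order dividing \<open>p\<close>, with their
  Gauss and Jacobi sums\<close>

locale gauss_setup = split_prime +
  fixes zq :: complex
  assumes zq_root: "zq ^ l = 1" and zq_neq_1: "zq \<noteq> 1"
begin

text \<open>The exponent to base \<open>k\<close> of the \<open>p\<close>-th power residue of
  \<open>x\<close>. The characters are then \<open>x \<mapsto> w ^ ind x\<close>, one for each
  \<open>p\<close>-th root of unity \<open>w\<close>. Values at multiples of \<open>l\<close> are
  arbitrary.\<close>

definition ind :: "nat \<Rightarrow> nat" where
  "ind x = (SOME i. i < p \<and> [x ^ ((l - 1) div p) = k ^ i] (mod l))"

lemma index_exponent_mult: "(l - 1) div p * p = l - 1"
  using p_dvd_l_minus_1 by simp

lemma index_exponent_bounds: "0 < (l - 1) div p" "(l - 1) div p < l - 1"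
proof -
  have "0 < l - 1" using l_gt_p p_gt_1 by simp
  then show "0 < (l - 1) div p" using index_exponent_mult by (metis gr0I mult_0)
  then show "(l - 1) div p < l - 1" using index_exponent_mult p_gt_1 \<open>0 < l - 1\<close> by simp
qed

text \<open>The powers of \<open>k\<close> are \<open>p\<close> distinct solutions of
  \<open>y ^ p = 1\<close> modulo \<open>l\<close>, hence all of them, and
  \<open>x ^ ((l - 1) div p)\<close> is a solution by Fermat.\<close>

lemma ind_works:
  assumes "\<not> l dvd x"
  shows "ind x < p" "[x ^ ((l - 1) div p) = k ^ ind x] (mod l)"
proof -
  define S where "S = {y\<in>{..<l}. [y ^ p = 1] (mod l)}"
  define T where "T = (\<lambda>i. k ^ i mod l) ` {..<p}"
  have "inj_on (\<lambda>i. k ^ i mod l) {..<p}"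
    using k_power_cong_iff unfolding cong_def inj_on_def by simp
  then have "card T = p" by (simp add: T_def card_image)
  moreover have "T \<subseteq> S"
  proof
    fix y assume "y \<in> T"
    then obtain i where y: "y = k ^ i mod l" by (auto simp: T_def)
    have "[k ^ (i * p) = k ^ 0] (mod l)" unfolding k_power_cong_iff by (simp add: cong_0_iff)
    then have "[y ^ p = 1] (mod l)" by (simp add: y cong_def power_mod flip: power_mult)
    then show "y \<in> S" using y l_gt_p by (simp add: S_def)
  qed
  moreover have "card S \<le> p"
    unfolding S_def by (rule roots_mod_prime_bound) (auto simp: l_prime)
  moreover have "finite S" by (simp add: S_def)
  ultimately have "T = S" by (intro card_subset_eq) (auto dest: card_mono intro: le_antisym)
  have "[x ^ (l - 1) = 1] (mod l)"
    using fermat_theorem[OF l_prime assms] .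
  then have "[(x ^ ((l - 1) div p)) ^ p = 1] (mod l)"
    by (simp only: index_exponent_mult power_mult[symmetric])
  then have "x ^ ((l - 1) div p) mod l \<in> S"
    using l_gt_p by (simp add: S_def cong_def power_mod)
  then have "x ^ ((l - 1) div p) mod l \<in> T" using \<open>T = S\<close> by simp
  then have "\<exists>i. i < p \<and> [x ^ ((l - 1) div p) = k ^ i] (mod l)"
    by (auto simp: T_def cong_def)
  from someI_ex[OF this] show "ind x < p" "[x ^ ((l - 1) div p) = k ^ ind x] (mod l)"
    by (simp_all add: ind_def)
qed

lemma ind_unique:
  assumes "\<not> l dvd x" "i < p" "[x ^ ((l - 1) div p) = k ^ i] (mod l)"
  shows "ind x = i"
proof -
  have "[k ^ ind x = k ^ i] (mod l)"
    using ind_works(2)[OF assms(1)] assms(3) cong_sym cong_trans by blast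
  then show ?thesis
    using ind_works(1)[OF assms(1)] assms(2) unfolding k_power_cong_iff by (simp add: cong_def)
qed

lemma ind_mod: "ind (x mod l) = ind x"
  by (simp add: ind_def cong_def power_mod)

lemma ind_mult:
  assumes "\<not> l dvd x" "\<not> l dvd y"
  shows "[ind (x * y) = ind x + ind y] (mod p)"
proof -
  have xy: "\<not> l dvd x * y" using assms l_prime by (simp add: prime_dvd_mult_iff)
  have "[(x * y) ^ ((l - 1) div p) = k ^ ind x * k ^ ind y] (mod l)"
    unfolding power_mult_distrib by (intro cong_mult ind_works assms)
  then have "[k ^ ind (x * y) = k ^ (ind x + ind y)] (mod l)"
    using ind_works(2)[OF xy] cong_sym cong_trans unfolding power_add by blast
  then show ?thesis by (simp add: k_power_cong_iff)
qed

lemma ind_1: "ind (Suc 0) = 0"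
  using l_gt_p p_gt_1 by (intro ind_unique) auto

lemma l_not_dvd: "x \<in> {1..<l} \<Longrightarrow> \<not> l dvd x"
  by (auto dest: dvd_imp_le)

text \<open>All these characters are even: the square of \<open>l - 1\<close> is 1 modulo
  \<open>l\<close>, and \<open>p\<close> is odd.\<close>

lemma ind_minus_1 [simp]: "ind (l - Suc 0) = 0"
proof -
  have nd: "\<not> l dvd l - 1" using l_gt_p p_gt_1 by (intro l_not_dvd) auto
  have "(l - 1) * (l - 1) = l * (l - 2) + 1"
    using l_gt_p p_gt_1 by (cases l) (auto simp: algebra_simps Suc_diff_Suc numeral_2_eq_2)
  then have "(l - 1) * (l - 1) mod l = 1 mod l" by (metis mod_mult_self4)
  then have "ind ((l - 1) * (l - 1)) = 0"
    using ind_mod[of "(l - 1) * (l - 1)"] ind_mod[of 1] ind_1 by simp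
  then have "p dvd 2 * ind (l - 1)"
    using ind_mult[OF nd nd] by (simp add: cong_def dvd_eq_mod_eq_0 mult_2)
  then have "p dvd 2 \<or> p dvd ind (l - 1)" using p_prime by (simp add: prime_dvd_mult_iff)
  moreover have "\<not> p dvd 2" using p_ge_3 by (auto dest: dvd_imp_le)
  ultimately have "ind (l - 1) = 0" using ind_works(1)[OF nd] by (auto dest: dvd_imp_le)
  then show ?thesis by simp
qed

lemma ind_nontrivial: obtains r where "r \<in> {1..<l}" "\<not> p dvd ind r"
proof -
  have "\<exists>r\<in>{1..<l}. ind r \<noteq> 0"
  proof (rule ccontr)
    assume *: "\<not> ?thesis"
    have "{1..<l} \<subseteq> {x\<in>{..<l}. [x ^ ((l - 1) div p) = 1] (mod l)}"
    proof
      fix x assume x: "x \<in> {1..<l}"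
      then show "x \<in> {x\<in>{..<l}. [x ^ ((l - 1) div p) = 1] (mod l)}"
        using ind_works(2)[OF l_not_dvd[OF x]] * by auto
    qed
    then have "card {1..<l} \<le> card {x\<in>{..<l}. [x ^ ((l - 1) div p) = 1] (mod l)}"
      by (intro card_mono) auto
    also have "\<dots> \<le> (l - 1) div p"
      using index_exponent_bounds by (intro roots_mod_prime_bound l_prime)
    finally show False using index_exponent_bounds by simp
  qed
  then obtain r where r: "r \<in> {1..<l}" "ind r \<noteq> 0" by blast
  then have "\<not> p dvd ind r"
    using ind_works(1)[OF l_not_dvd[OF r(1)]] by (auto dest: dvd_imp_le)
  then show ?thesis using that r by blast
qed

lemma char_mult:
  assumes "w ^ p = (1::complex)" "\<not> l dvd x" "\<not> l dvd y"
  shows "w ^ ind (x * y mod l) = w ^ ind x * w ^ ind y"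
  unfolding ind_mod power_add[symmetric] by (rule power_root_cong[OF assms(1) ind_mult[OF assms(2,3)]])

text \<open>Multiplying the summation variable by an \<open>r\<close> with \<open>w ^ ind r\<close>
  different from 1 rescales the sum without changing it.\<close>

lemma sum_char:
  assumes w: "w ^ p = (1::complex)" "w \<noteq> 1"
  shows "(\<Sum>x\<in>{1..<l}. w ^ ind x) = 0"
proof -
  obtain r where r: "r \<in> {1..<l}" "\<not> p dvd ind r" by (rule ind_nontrivial)
  have nr: "\<not> l dvd r" using r l_not_dvd by blast
  have neq: "w ^ ind r \<noteq> 1"
  proof
    assume eq: "w ^ ind r = 1"
    have "coprime (ind r) p" using r p_prime prime_imp_coprime coprime_commute by blast
    then obtain m where "[ind r * m = 1] (mod p)" using cong_solve_coprime_nat[of "ind r" p] by auto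
    then have "w ^ (ind r * m) = w ^ 1" using power_root_cong w by blast
    then show False using eq w by (simp add: power_mult)
  qed
  have "(\<Sum>x\<in>{1..<l}. w ^ ind x) = (\<Sum>x\<in>{1..<l}. w ^ ind (r * x mod l))"
    using sum.reindex_bij_betw[OF bij_betw_mult_mod_prime[OF l_prime nr], of "\<lambda>x. w ^ ind x"] by simp
  also have "\<dots> = (\<Sum>x\<in>{1..<l}. w ^ ind r * w ^ ind x)"
    by (intro sum.cong refl char_mult[OF w(1) nr l_not_dvd])
  also have "\<dots> = w ^ ind r * (\<Sum>x\<in>{1..<l}. w ^ ind x)"
    by (simp only: sum_distrib_left)
  finally show ?thesis using neq by (metis mult_cancel_right1)
qed

text \<open>The Gauss sum as a function of the root of unity \<open>w\<close> that indexes the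
  character. Products of characters become products of arguments.\<close>

definition G :: "complex \<Rightarrow> complex" where
  "G w = (\<Sum>x\<in>{1..<l}. w ^ ind x * zq ^ x)"

text \<open>The usual Jacobi sum of two characters, after the substitution that makes the arguments \<open>t\<close> and
  \<open>t + 1\<close>, so that no residue needs to be reduced.\<close>

definition J :: "complex \<Rightarrow> complex \<Rightarrow> complex" where
  "J a b = (\<Sum>t\<in>{1..<l - 1}. b ^ ind t * inverse ((a * b) ^ ind (Suc t)))"

lemma G_scale:
  assumes w: "w ^ p = 1" and c: "\<not> l dvd c"
  shows "(\<Sum>x\<in>{1..<l}. w ^ ind x * zq ^ (c * x)) = inverse (w ^ ind c) * G w"
proof -
  have "w \<noteq> 0" using w by (auto simp: power_0_left)
  have "G w = (\<Sum>x\<in>{1..<l}. w ^ ind (c * x mod l) * zq ^ (c * x mod l))"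
    unfolding G_def
    using sum.reindex_bij_betw[OF bij_betw_mult_mod_prime[OF l_prime c], of "\<lambda>x. w ^ ind x * zq ^ x"] by simp
  also have "\<dots> = (\<Sum>x\<in>{1..<l}. w ^ ind c * (w ^ ind x * zq ^ (c * x)))"
    using char_mult[OF w c l_not_dvd] by (simp add: power_mod_exponent[OF zq_root] mult.assoc)
  finally show ?thesis using \<open>w \<noteq> 0\<close> by (simp flip: sum_distrib_left)
qed

lemma residues_split: "{1..<l} = insert (l - 1) {1..<l - 1}" "{1..<l} = insert 1 (Suc ` {1..<l - 1})"
proof -
  show "{1..<l} = insert (l - 1) {1..<l - 1}" using l_gt_p p_gt_1 by auto
  have "{1..<l} = {1..<Suc (l - 1)}" using l_gt_p by simp
  then show "{1..<l} = insert 1 (Suc ` {1..<l - 1})"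
    using l_gt_p p_gt_1 by (auto simp: image_Suc_atLeastLessThan)
qed

text \<open>Putting \<open>y = x * t\<close> in the double sum produces
  \<open>zq ^ ((t + 1) * x)\<close>. The term with \<open>t + 1 = l\<close> is a plain character
  sum, and rescaling turns every other inner sum into a multiple of
  \<open>G (a * b)\<close>.\<close>

lemma G_mult:
  assumes a: "a ^ p = 1" and b: "b ^ p = 1"
  shows "G a * G b = (\<Sum>x\<in>{1..<l}. (a * b) ^ ind x) + G (a * b) * J a b"
proof -
  have ab: "(a * b) ^ p = 1" using a b by (simp add: power_mult_distrib)
  have "G a * G b = (\<Sum>x\<in>{1..<l}. a ^ ind x * zq ^ x * G b)"
    by (simp add: G_def sum_distrib_right)
  also have "\<dots> = (\<Sum>x\<in>{1..<l}. \<Sum>t\<in>{1..<l}. b ^ ind t * ((a * b) ^ ind x * zq ^ (Suc t * x)))"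
  proof (intro sum.cong refl)
    fix x assume x: "x \<in> {1..<l}"
    have nx: "\<not> l dvd x" using x by (rule l_not_dvd)
    have "G b = (\<Sum>t\<in>{1..<l}. b ^ ind (x * t mod l) * zq ^ (x * t mod l))"
      unfolding G_def
      using sum.reindex_bij_betw[OF bij_betw_mult_mod_prime[OF l_prime nx], of "\<lambda>x. b ^ ind x * zq ^ x"] by simp
    also have "\<dots> = (\<Sum>t\<in>{1..<l}. b ^ ind x * b ^ ind t * zq ^ (x * t))"
      using char_mult[OF b nx l_not_dvd] by (simp add: power_mod_exponent[OF zq_root])
    finally show "a ^ ind x * zq ^ x * G b
        = (\<Sum>t\<in>{1..<l}. b ^ ind t * ((a * b) ^ ind x * zq ^ (Suc t * x)))"
      by (simp add: sum_distrib_left power_mult_distrib power_add mult_ac)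
  qed
  also have "\<dots> = (\<Sum>t\<in>{1..<l}. b ^ ind t * (\<Sum>x\<in>{1..<l}. (a * b) ^ ind x * zq ^ (Suc t * x)))"
    by (subst sum.swap) (simp only: sum_distrib_left)
  also have "\<dots> = b ^ ind (l - 1) * (\<Sum>x\<in>{1..<l}. (a * b) ^ ind x * zq ^ (Suc (l - 1) * x))
      + (\<Sum>t\<in>{1..<l - 1}. b ^ ind t * (\<Sum>x\<in>{1..<l}. (a * b) ^ ind x * zq ^ (Suc t * x)))"
    by (subst residues_split(1), subst sum.insert) auto
  also have "(\<Sum>x\<in>{1..<l}. (a * b) ^ ind x * zq ^ (Suc (l - 1) * x)) = (\<Sum>x\<in>{1..<l}. (a * b) ^ ind x)"
  proof -
    have zq1: "zq ^ (Suc (l - 1) * x) = 1" for x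
      using l_gt_p by (simp add: power_mult zq_root del: mult_Suc)
    show ?thesis by (simp only: zq1 mult_1_right)
  qed
  also have "(\<Sum>t\<in>{1..<l - 1}. b ^ ind t * (\<Sum>x\<in>{1..<l}. (a * b) ^ ind x * zq ^ (Suc t * x)))
      = (\<Sum>t\<in>{1..<l - 1}. b ^ ind t * (inverse ((a * b) ^ ind (Suc t)) * G (a * b)))"
  proof (intro sum.cong refl)
    fix t assume "t \<in> {1..<l - 1}"
    then have "\<not> l dvd Suc t" by (intro l_not_dvd) auto
    show "b ^ ind t * (\<Sum>x\<in>{1..<l}. (a * b) ^ ind x * zq ^ (Suc t * x))
        = b ^ ind t * (inverse ((a * b) ^ ind (Suc t)) * G (a * b))"
      by (simp only: G_scale[OF ab \<open>\<not> l dvd Suc t\<close>])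
  qed
  finally show ?thesis by (simp add: ind_minus_1 J_def sum_distrib_left mult_ac)
qed

lemma sum_char_partial:
  assumes "w ^ p = (1::complex)" "w \<noteq> 1"
  shows "(\<Sum>t\<in>{1..<l - 1}. w ^ ind t) = -1" "(\<Sum>t\<in>{1..<l - 1}. w ^ ind (Suc t)) = -1"
proof -
  have "w ^ ind (l - 1) + (\<Sum>t\<in>{1..<l - 1}. w ^ ind t) = 0"
    using sum_char[OF assms] unfolding residues_split(1) by (subst (asm) sum.insert) auto
  then show "(\<Sum>t\<in>{1..<l - 1}. w ^ ind t) = -1"
    by (simp add: ind_minus_1 add_eq_0_iff)
  have "w ^ ind 1 + (\<Sum>t\<in>{1..<l - 1}. w ^ ind (Suc t)) = 0"
    using sum_char[OF assms] unfolding residues_split(2)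
    by (subst (asm) sum.insert) (auto simp: sum.reindex simp del: image_Suc_atLeastLessThan)
  then show "(\<Sum>t\<in>{1..<l - 1}. w ^ ind (Suc t)) = -1"
    by (simp add: ind_1 add_eq_0_iff)
qed

lemma G_1: "G 1 = -1"
proof -
  have "(\<Sum>x<l. zq ^ x) = 0"
    using ev_cyclotomic_prime[OF zq_root zq_neq_1] by (simp add: cyclotomic_prime_def)
  moreover have "{..<l} = insert 0 {1..<l}" using l_gt_p by auto
  ultimately show ?thesis by (simp add: G_def add_eq_0_iff)
qed

text \<open>The product character is trivial, so the plain sum is \<open>l - 1\<close>, while
  \<open>G 1\<close> and the Jacobi sum are both \<open>-1\<close>.\<close>

lemma G_inverse:
  assumes "a ^ p = 1" "a \<noteq> 1"
  shows "G a * G (inverse a) = of_nat l"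
proof -
  have a0: "a \<noteq> 0" using assms by (auto simp: power_0_left)
  have ia: "inverse a ^ p = 1" "inverse a \<noteq> 1" using assms by (auto simp: power_inverse)
  have "J a (inverse a) = -1"
    using sum_char_partial(1)[OF ia] a0 by (simp add: J_def)
  then show ?thesis
    using G_mult[OF assms(1) ia(1)] a0 G_1 l_gt_p by (simp add: of_nat_diff)
qed

text \<open>Conjugation inverts \<open>a\<close> and \<open>zq\<close>. Inverting \<open>zq\<close>
  rescales by \<open>l - 1\<close>, which has no effect because the characters are even.\<close>

lemma norm_G_sq:
  assumes "a ^ p = 1" "a \<noteq> 1"
  shows "G a * cnj (G a) = of_nat l"
proof -
  have nd: "\<not> l dvd l - 1" using l_gt_p p_gt_1 by (intro l_not_dvd) auto
  have ia: "inverse a ^ p = 1" using assms by (auto simp: power_inverse)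
  have "zq ^ (l - 1) = cnj zq"
    using cnj_root_of_unity(1)[OF zq_root] l_gt_p by simp
  then have "cnj (G a) = (\<Sum>x\<in>{1..<l}. inverse a ^ ind x * zq ^ ((l - 1) * x))"
    using cnj_root_of_unity(3)[OF assms(1)] by (simp add: G_def power_mult)
  also have "\<dots> = G (inverse a)"
    by (subst G_scale[OF ia nd]) (simp add: ind_minus_1)
  finally show ?thesis using G_inverse[OF assms] by simp
qed

text \<open>One factor \<open>G (z ^ t)\<close> is absorbed at a time. The bound on \<open>n\<close>
  keeps each product character nontrivial, so the plain character sums vanish.\<close>

lemma G_power:
  assumes "\<not> p dvd t" "n < p - 1"
  shows "G (z ^ t) ^ Suc n = (\<Prod>i\<in>{1..n}. J (z ^ t) ((z ^ t) ^ i)) * G ((z ^ t) ^ Suc n)"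
  using assms(2)
proof (induction n)
  case (Suc n)
  have "\<not> p dvd Suc (Suc n)" using Suc.prems by (auto dest: dvd_imp_le)
  then have "\<not> p dvd t * Suc (Suc n)" using assms(1) p_prime by (simp only: prime_dvd_mult_iff) simp
  then have n1: "z ^ t * (z ^ t) ^ Suc n \<noteq> 1"
    using z_power_neq_1[of "t * Suc (Suc n)"] by (simp only: power_mult power_Suc not_False_eq_True)
  have r: "((z ^ t) ^ j) ^ p = 1" for j
    by (metis power_mult z_power_root)
  have r2: "(z ^ t * (z ^ t) ^ Suc n) ^ p = 1" using r[of "Suc (Suc n)"] by simp
  have "G (z ^ t) ^ Suc (Suc n) = G (z ^ t) * G (z ^ t) ^ Suc n" by simp
  also have "\<dots> = (\<Prod>i\<in>{1..n}. J (z ^ t) ((z ^ t) ^ i)) * (G (z ^ t) * G ((z ^ t) ^ Suc n))"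
    using Suc by (simp only: Suc.IH[OF Suc_lessD[OF Suc.prems]] mult_ac)
  also have "G (z ^ t) * G ((z ^ t) ^ Suc n) = G (z ^ t * (z ^ t) ^ Suc n) * J (z ^ t) ((z ^ t) ^ Suc n)"
    by (simp only: G_mult[OF z_power_root r] sum_char[OF r2 n1] add_0_left)
  finally show ?case by (simp add: mult_ac)
qed simp

text \<open>After \<open>p - 1\<close> factors the remaining Gauss sum belongs to the inverse
  character. Multiplied by the last factor it gives \<open>l\<close>.\<close>

lemma G_power_p:
  assumes t: "\<not> p dvd t"
  shows "G (z ^ t) ^ p = of_nat l * (\<Prod>i\<in>{1..p - 2}. J (z ^ t) ((z ^ t) ^ i))"
proof -
  have p: "p = Suc (Suc (p - 2))" using p_ge_3 by simp
  have "G (z ^ t) ^ p = G (z ^ t) * G (z ^ t) ^ Suc (p - 2)" by (metis p power_Suc)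
  also have "G (z ^ t) ^ Suc (p - 2) = (\<Prod>i\<in>{1..p - 2}. J (z ^ t) ((z ^ t) ^ i)) * G ((z ^ t) ^ Suc (p - 2))"
    using p_ge_3 by (intro G_power t) auto
  also have "(z ^ t) ^ Suc (p - 2) = inverse (z ^ t)"
  proof -
    have "z ^ t * (z ^ t) ^ Suc (p - 2) = (z ^ t) ^ p" by (metis p power_Suc)
    then show ?thesis by (metis inverse_unique z_power_root)
  qed
  finally show ?thesis
    using G_inverse[OF z_power_root z_power_neq_1[OF t]] by (simp add: mult_ac)
qed

end

section \<open>Jacobi sums modulo \<open>l\<close> and modulo \<open>(zeta - 1) ^ 2\<close>\<close>

context gauss_setup begin

text \<open>The Jacobi sum \<open>J w (w ^ i)\<close> as a polynomial in \<open>w\<close>: the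
  exponent \<open>p - 1\<close> replaces the inverse, so that integers can be inserted for
  \<open>w\<close>.\<close>

definition jacobi_poly :: "nat \<Rightarrow> int poly" where
  "jacobi_poly i = (\<Sum>t\<in>{1..<l - 1}. monom 1 (i * ind t + (p - 1) * (i + 1) * ind (Suc t)))"

definition gauss_poly :: "int poly" where
  "gauss_poly = of_nat l * (\<Prod>i\<in>{1..p - 2}. jacobi_poly i)"

lemma J_eq:
  assumes w: "w ^ p = 1"
  shows "J w (w ^ i) = (\<Sum>t\<in>{1..<l - 1}. (w ^ i) ^ ind t * (w ^ ((p - 1) * (i + 1))) ^ ind (Suc t))"
proof -
  have "inverse (w * w ^ i) = w ^ ((p - 1) * (i + 1))"
  proof (rule inverse_unique)
    have "Suc i + (p - 1) * (i + 1) = p * (i + 1)" using p_gt_1 by (cases p) auto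
    then have "w * w ^ i * w ^ ((p - 1) * (i + 1)) = w ^ (p * (i + 1))"
      by (metis power_Suc power_add)
    then show "w * w ^ i * w ^ ((p - 1) * (i + 1)) = 1"
      by (simp only: power_mult w power_one)
  qed
  then show ?thesis unfolding J_def by (simp add: power_inverse[symmetric])
qed

lemma ev_jacobi_poly:
  assumes w: "w ^ p = 1"
  shows "ev (jacobi_poly i) w = J w (w ^ i)"
  unfolding J_eq[OF w] jacobi_poly_def by (simp add: power_add power_mult)

lemma ev_gauss_poly: "\<not> p dvd t \<Longrightarrow> ev gauss_poly (z ^ t) = G (z ^ t) ^ p"
  by (simp add: gauss_poly_def ev_jacobi_poly G_power_p)

text \<open>At \<open>k ^ (- s)\<close> the characters become powers of \<open>t\<close> and
  \<open>t + 1\<close> modulo \<open>l\<close>, with exponents \<open>K * a\<close> and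
  \<open>K * b\<close>. Since \<open>a + b = s < p\<close>, the total degree is below
  \<open>l - 1\<close> and the power sum vanishes modulo \<open>l\<close>.\<close>

lemma jacobi_poly_dvd:
  assumes s: "s \<in> {1..<p}" and i: "p - s < s * i mod p"
  shows "int l dvd poly (jacobi_poly i) (int k ^ ((p - 1) * s))"
proof -
  define K where "K = (l - 1) div p"
  define x where "x = s * i mod p"
  \<comment> \<open>The numbers \<open>a\<close> and \<open>b\<close> represent
    \<open>- s * i\<close> and \<open>s * (i + 1)\<close> modulo \<open>p\<close>. The hypothesis on
    \<open>i\<close> says exactly that \<open>b\<close> is positive.\<close>
  define a where "a = p - x"
  define b where "b = x + s - p"
  have xp: "x < p" by (simp add: x_def)
  have a: "a > 0" and b: "b > 0" and ab: "a + b = s"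
    using i s xp by (auto simp: a_def b_def x_def[symmetric])
  have ca: "[(p - 1) * s * i = a] (mod p)"
  proof -
    have "(p - 1) * s * i + s * i = p * (s * i)"
      using p_gt_1 by (simp add: algebra_simps)
    then have 1: "[(p - 1) * s * i + s * i = 0] (mod p)" by (simp only: cong_0_iff dvd_triv_left)
    have "a + s * i = a + (x + p * (s * i div p))" by (simp add: x_def)
    also have "\<dots> = p * (1 + s * i div p)" using xp by (simp add: a_def)
    finally have "[a + s * i = 0] (mod p)" by (simp only: cong_0_iff dvd_triv_left)
    then have "[(p - 1) * s * i + s * i = a + s * i] (mod p)" using 1 cong_sym cong_trans by blast
    then show ?thesis by (simp only: cong_add_rcancel_nat)
  qed
  have cb: "[(p - 1) * s * ((p - 1) * (i + 1)) = b] (mod p)"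
  proof -
    have "(p - 1) * (p - 1) = p * (p - 2) + 1"
      using p_gt_1 by (cases p) (auto simp: algebra_simps Suc_diff_Suc numeral_2_eq_2)
    then have "[(p - 1) * (p - 1) = 1] (mod p)"
      unfolding cong_def by (metis mod_mult_self4)
    then have "[((p - 1) * (p - 1)) * (s * (i + 1)) = 1 * (s * (i + 1))] (mod p)"
      by (rule cong_scalar_right)
    also have "[1 * (s * (i + 1)) = x + s] (mod p)"
      by (simp add: x_def cong_def algebra_simps mod_add_right_eq)
    also have "[x + s = b] (mod p)"
      using b by (simp add: b_def cong_def le_mod_geq)
    finally show ?thesis by (simp only: mult_ac)
  qed
  have "[(\<Sum>t\<in>{1..<l - 1}. k ^ ((p - 1) * s * (i * ind t + (p - 1) * (i + 1) * ind (Suc t))))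
      = (\<Sum>t\<in>{1..<l - 1}. t ^ (K * a) * (t + 1) ^ (K * b))] (mod l)"
  proof (rule cong_sum)
    fix t assume t: "t \<in> {1..<l - 1}"
    have t1: "\<not> l dvd t" and t2: "\<not> l dvd Suc t" using t by (intro l_not_dvd; auto)+
    have "(p - 1) * s * (i * ind t + (p - 1) * (i + 1) * ind (Suc t))
        = (p - 1) * s * i * ind t + (p - 1) * s * ((p - 1) * (i + 1)) * ind (Suc t)"
      by (simp only: distrib_left distrib_right mult.assoc)
    moreover have "[\<dots> = a * ind t + b * ind (Suc t)] (mod p)"
      by (intro cong_add cong_scalar_right ca cb)
    ultimately have "[k ^ ((p - 1) * s * (i * ind t + (p - 1) * (i + 1) * ind (Suc t)))
        = k ^ (a * ind t + b * ind (Suc t))] (mod l)"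
      by (simp only: k_power_cong_iff)
    also have "k ^ (a * ind t + b * ind (Suc t)) = (k ^ ind t) ^ a * (k ^ ind (Suc t)) ^ b"
      by (simp add: power_add mult.commute flip: power_mult)
    also have "[\<dots> = (t ^ K) ^ a * (Suc t ^ K) ^ b] (mod l)"
      unfolding K_def by (intro cong_mult cong_pow cong_sym[OF ind_works(2)] t1 t2)
    finally show "[k ^ ((p - 1) * s * (i * ind t + (p - 1) * (i + 1) * ind (Suc t)))
        = t ^ (K * a) * (t + 1) ^ (K * b)] (mod l)"
      by (simp add: power_mult)
  qed
  moreover have "l dvd (\<Sum>t\<in>{1..<l - 1}. t ^ (K * a) * (t + 1) ^ (K * b))"
  proof -
    have K: "K > 0" "K * p = l - 1" using index_exponent_bounds index_exponent_mult by (simp_all add: K_def)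
    have "K * a + K * b = K * s" by (simp add: ab flip: distrib_left)
    also have "\<dots> < K * p" using K(1) s by simp
    finally have "l dvd (\<Sum>x<l. x ^ (K * a) * (x + 1) ^ (K * b))"
      using K by (intro sum_jacobi_mod_prime l_prime) simp
    \<comment> \<open>The two additional terms vanish modulo \<open>l\<close>: \<open>x = 0\<close>
      because \<open>a > 0\<close>, and \<open>x = l - 1\<close> because
      \<open>b > 0\<close>.\<close>
    also have "{..<l} = insert 0 (insert (l - 1) {1..<l - 1})"
      using l_gt_p p_gt_1 by auto
    also have "(\<Sum>x\<in>\<dots>. x ^ (K * a) * (x + 1) ^ (K * b))
        = (l - 1) ^ (K * a) * l ^ (K * b) + (\<Sum>t\<in>{1..<l - 1}. t ^ (K * a) * (t + 1) ^ (K * b))"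
      using l_gt_p p_gt_1 K a by simp
    finally show ?thesis
    proof (rule dvd_add_right_iff[THEN iffD1, rotated])
      show "l dvd (l - 1) ^ (K * a) * l ^ (K * b)"
        using K b by (intro dvd_mult dvd_power) auto
    qed
  qed
  ultimately have "l dvd (\<Sum>t\<in>{1..<l - 1}. k ^ ((p - 1) * s * (i * ind t + (p - 1) * (i + 1) * ind (Suc t))))"
    using cong_dvd_iff by blast
  then have "int l dvd int (\<Sum>t\<in>{1..<l - 1}. k ^ ((p - 1) * s * (i * ind t + (p - 1) * (i + 1) * ind (Suc t))))"
    by (simp only: int_dvd_int_iff)
  also have "int (\<Sum>t\<in>{1..<l - 1}. k ^ ((p - 1) * s * (i * ind t + (p - 1) * (i + 1) * ind (Suc t))))
      = poly (jacobi_poly i) (int k ^ ((p - 1) * s))"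
    by (simp only: jacobi_poly_def poly_sum poly_monom of_nat_sum of_nat_power power_mult[symmetric] mult_1)
  finally show ?thesis .
qed

text \<open>This is the half of Stickelberger's theorem that is needed; the opposite inequality comes
  from comparing absolute values.\<close>

lemma gauss_poly_dvd:
  assumes s: "s \<in> {1..<p}"
  shows "int l ^ s dvd poly gauss_poly (int k ^ ((p - 1) * s))"
proof -
  \<comment> \<open>\<open>I\<close> collects indices whose Jacobi sum contributes a factor
    \<open>l\<close>. Multiplication by \<open>s\<close> permutes the residues, so \<open>I\<close>
    has \<open>s - 1\<close> elements; the factor \<open>l\<close> in \<open>gauss_poly\<close> is
    the \<open>s\<close>-th.\<close>
  define I where "I = {i\<in>{1..<p}. p - s < s * i mod p}"
  have bij: "bij_betw (\<lambda>i. s * i mod p) {1..<p} {1..<p}"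
    using s by (intro bij_betw_mult_mod_prime p_prime not_dvd_range)
  have "(\<lambda>i. s * i mod p) ` I = {p - s<..<p}"
  proof -
    have "(\<lambda>i. s * i mod p) ` I = (\<lambda>i. s * i mod p) ` {1..<p} \<inter> {p - s<..}"
      by (auto simp: I_def)
    also have "\<dots> = {p - s<..<p}" using s bij by (auto simp: bij_betw_def)
    finally show ?thesis .
  qed
  moreover have "inj_on (\<lambda>i. s * i mod p) I"
    using bij unfolding bij_betw_def by (rule inj_on_subset[OF conjunct1]) (auto simp: I_def)
  ultimately have "card I = card {p - s<..<p}" by (metis card_image)
  then have card: "Suc (card I) = s" using s by simp
  have sub: "I \<subseteq> {1..p - 2}"
  proof
    fix i assume i: "i \<in> I"
    have "i \<noteq> p - 1"
    proof
      assume "i = p - 1"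
      then have "s * i + s = p * s" using p_gt_1 by (simp add: algebra_simps)
      then have "[s * i + s = (p - s) + s] (mod p)" using s by (simp add: cong_def)
      then have "[s * i = p - s] (mod p)" by (simp only: cong_add_rcancel_nat)
      then have "s * i mod p = p - s" using s by (simp add: cong_def)
      then show False using i by (simp add: I_def)
    qed
    then show "i \<in> {1..p - 2}" using i by (auto simp: I_def)
  qed
  have "int l ^ card I = (\<Prod>i\<in>I. int l)" by simp
  also have "\<dots> dvd (\<Prod>i\<in>I. poly (jacobi_poly i) (int k ^ ((p - 1) * s)))"
    by (intro prod_dvd_prod jacobi_poly_dvd s) (simp add: I_def)
  also have "\<dots> dvd (\<Prod>i\<in>{1..p - 2}. poly (jacobi_poly i) (int k ^ ((p - 1) * s)))"
    using sub by (intro prod_dvd_prod_subset) auto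
  finally have "int l * int l ^ card I dvd poly gauss_poly (int k ^ ((p - 1) * s))"
    by (simp add: gauss_poly_def poly_prod)
  then show ?thesis by (simp flip: card)
qed

text \<open>The sum of products \<open>(chi - 1) * (psi - 1)\<close> is divisible by
  \<open>lam\<^sup>2\<close> term by term. Expanded, it is the sum in question plus
  \<open>l\<close>, and \<open>l\<close> is 1 modulo \<open>lam\<^sup>2\<close>.\<close>

lemma jacobi_cong:
  assumes "\<not> p dvd m" "\<not> p dvd n"
  shows "congR (lam\<^sup>2) (\<Sum>t\<in>{1..<l - 1}. (z ^ m) ^ ind t * (z ^ n) ^ ind (Suc t)) (-1)"
proof -
  let ?S = "\<Sum>t\<in>{1..<l - 1}. (z ^ m) ^ ind t * (z ^ n) ^ ind (Suc t)"
  have "(\<Sum>t\<in>{1..<l - 1}. ((z ^ m) ^ ind t - 1) * ((z ^ n) ^ ind (Suc t) - 1))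
      = ?S - (\<Sum>t\<in>{1..<l - 1}. (z ^ m) ^ ind t) - (\<Sum>t\<in>{1..<l - 1}. (z ^ n) ^ ind (Suc t)) + of_nat (l - 2)"
    by (simp add: algebra_simps sum.distrib sum_subtractf numeral_2_eq_2)
  also have "\<dots> = ?S + of_nat l"
    unfolding sum_char_partial(1)[OF z_power_root z_power_neq_1[OF assms(1)]]
      sum_char_partial(2)[OF z_power_root z_power_neq_1[OF assms(2)]]
    using l_gt_p p_gt_1 by (simp add: of_nat_diff)
  finally have *: "?S + of_nat l = (\<Sum>t\<in>{1..<l - 1}. ((z ^ m) ^ ind t - 1) * ((z ^ n) ^ ind (Suc t) - 1))" ..
  have "\<forall>t. \<exists>c\<in>R. ((z ^ m) ^ ind t - 1) * ((z ^ n) ^ ind (Suc t) - 1) = lam\<^sup>2 * c"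
  proof
    fix t
    obtain c d where "c \<in> R" "(z ^ m) ^ ind t - 1 = lam * c" "d \<in> R" "(z ^ n) ^ ind (Suc t) - 1 = lam * d"
      using z_power_minus_1[of "m * ind t"] z_power_minus_1[of "n * ind (Suc t)"] by (auto simp: power_mult)
    then show "\<exists>c\<in>R. ((z ^ m) ^ ind t - 1) * ((z ^ n) ^ ind (Suc t) - 1) = lam\<^sup>2 * c"
      by (intro bexI[of _ "c * d"]) (auto simp: power2_eq_square mult_ac)
  qed
  then obtain c where c: "\<And>t. c t \<in> R"
      "\<And>t. ((z ^ m) ^ ind t - 1) * ((z ^ n) ^ ind (Suc t) - 1) = lam\<^sup>2 * c t" by metis
  have "?S + of_nat l = lam\<^sup>2 * (\<Sum>t\<in>{1..<l - 1}. c t)"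
    unfolding * by (simp only: c(2) sum_distrib_left)
  then have 1: "congR (lam\<^sup>2) (?S + of_nat l) 0"
    unfolding congR_def using c(1) by (intro bexI[of _ "\<Sum>t\<in>{1..<l - 1}. c t"]) auto
  obtain j where j: "l - 1 = p * j" using p_dvd_l_minus_1 ..
  have "congR (lam\<^sup>2) (of_nat p * - of_nat j) (0 * - of_nat j)"
    by (intro congR_mult p_cong_0_lam2) auto
  moreover have "- of_nat l = of_nat p * - of_nat j + (-1 :: complex)"
    using arg_cong[OF j, of "of_nat :: nat \<Rightarrow> complex"] l_gt_p by (simp add: of_nat_diff algebra_simps)
  ultimately have 2: "congR (lam\<^sup>2) (- of_nat l) (-1)"
    by (simp add: congR_def)
  show ?thesis using congR_add[OF 1 2] by simp
qed

text \<open>The factor \<open>l\<close> is 1, each of the \<open>p - 2\<close> Jacobi sums is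
  \<open>-1\<close>, and \<open>p - 2\<close> is odd.\<close>

lemma G_power_p_cong:
  assumes t: "\<not> p dvd t"
  shows "congR (lam\<^sup>2) (ev gauss_poly (z ^ t)) (-1)"
proof -
  have inR: "ev f (z ^ t) \<in> R" for f
    using ev_in_R[of "pcompose f (monom 1 t)"] by simp
  have Jc: "congR (lam\<^sup>2) (ev (jacobi_poly i) (z ^ t)) (-1)" if i: "i \<in> {1..p - 2}" for i
  proof -
    have "\<not> p dvd i" "\<not> p dvd i + 1" "\<not> p dvd p - 1" using i p_ge_3 by (auto dest!: dvd_imp_le)
    then have "\<not> p dvd t * i" "\<not> p dvd t * ((p - 1) * (i + 1))"
      using t p_prime by (simp_all only: prime_dvd_mult_iff) auto
    from jacobi_cong[OF this] show ?thesis
      by (simp only: ev_jacobi_poly[OF z_power_root] J_eq[OF z_power_root] power_mult)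
  qed
  have lc: "congR (lam\<^sup>2) (of_nat l) 1"
  proof -
    obtain j where j: "l - 1 = p * j" using p_dvd_l_minus_1 ..
    have "congR (lam\<^sup>2) (of_nat p * of_nat j) (0 * of_nat j)"
      by (intro congR_mult p_cong_0_lam2) auto
    moreover have "of_nat l - 1 = of_nat p * (of_nat j :: complex)"
      using arg_cong[OF j, of "of_nat :: nat \<Rightarrow> complex"] l_gt_p by (simp add: of_nat_diff)
    ultimately show ?thesis by (simp add: congR_def)
  qed
  have "congR (lam\<^sup>2) (of_nat l * (\<Prod>i\<in>{1..p - 2}. ev (jacobi_poly i) (z ^ t))) (1 * (\<Prod>i\<in>{1..p - 2}. -1))"
    by (intro congR_mult lc congR_prod Jc R_prod inR) auto
  also have "odd (p - 2)" using p_odd p_ge_3 by simp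
  then have "1 * (\<Prod>i\<in>{1..p - 2}. -1) = (-1 :: complex)" by simp
  finally show ?thesis by (simp add: gauss_poly_def)
qed

end

section \<open>The Stickelberger element\<close>

context prime_cyclotomic begin

text \<open>Fermat's formula for the inverse is chosen because it matches the exponents
  \<open>vneg\<close>.\<close>

definition inv_mod :: "nat \<Rightarrow> nat" where
  "inv_mod s = s ^ (p - 2) mod p"

lemma inv_mod_mult: "s \<in> {1..<p} \<Longrightarrow> [s * inv_mod s = 1] (mod p)"
proof -
  assume s: "s \<in> {1..<p}"
  have "Suc (p - 2) = p - 1" using p_ge_3 by simp
  then have "s * s ^ (p - 2) = s ^ (p - 1)" by (metis power_Suc)
  then show ?thesis
    using fermat_theorem[OF p_prime not_dvd_range[OF s]]
    by (simp add: inv_mod_def cong_def mod_mult_right_eq)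
qed

lemma inv_mod_range: "s \<in> {1..<p} \<Longrightarrow> inv_mod s \<in> {1..<p}"
proof -
  assume s: "s \<in> {1..<p}"
  have "inv_mod s \<noteq> 0"
  proof
    assume "inv_mod s = 0"
    then show False using inv_mod_mult[OF s] p_gt_1 by (simp add: cong_def)
  qed
  then show ?thesis by (simp add: inv_mod_def)
qed

lemma inv_mod_unique:
  assumes "s \<in> {1..<p}" "t \<in> {1..<p}" "[s * t = 1] (mod p)"
  shows "t = inv_mod s"
proof -
  have "coprime s p"
    using not_dvd_range[OF assms(1)] p_prime prime_imp_coprime coprime_commute by blast
  moreover have "[s * t = s * inv_mod s] (mod p)"
    using inv_mod_mult[OF assms(1)] assms(3) cong_sym cong_trans by blast
  ultimately have "[t = inv_mod s] (mod p)" using cong_mult_lcancel_nat by blast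
  then show ?thesis using assms(2) inv_mod_range[OF assms(1)] by (simp add: cong_def)
qed

lemma inv_mod_iv: "s \<in> {1..<p} \<Longrightarrow> inv_mod (inv_mod s) = s"
  using inv_mod_unique[of "inv_mod s" s] inv_mod_range inv_mod_mult by (simp add: mult.commute)

lemma bij_inv_mod: "bij_betw inv_mod {1..<p} {1..<p}"
  by (rule bij_betw_byWitness[where f' = inv_mod]) (use inv_mod_iv inv_mod_range in auto)

lemma inv_mod_reflect: "s \<in> {1..<p} \<Longrightarrow> inv_mod (p - s) = p - inv_mod s"
proof -
  assume s: "s \<in> {1..<p}"
  have r: "inv_mod s \<in> {1..<p}" using inv_mod_range[OF s] .
  have "int ((p - s) * (p - inv_mod s)) - int (s * inv_mod s) = int p * (int p - int s - int (inv_mod s))"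
  proof -
    have "int (p - s) = int p - int s" "int (p - inv_mod s) = int p - int (inv_mod s)" using s r by auto
    then show ?thesis by (simp only: of_nat_mult) (simp add: algebra_simps)
  qed
  then have "[int ((p - s) * (p - inv_mod s)) = int (s * inv_mod s)] (mod int p)"
    by (simp add: cong_iff_dvd_diff)
  then have "[(p - s) * (p - inv_mod s) = s * inv_mod s] (mod p)" by (simp only: cong_int_iff)
  then have "[(p - s) * (p - inv_mod s) = 1] (mod p)" using inv_mod_mult[OF s] cong_trans by blast
  then have "p - inv_mod s = inv_mod (p - s)"
    using s r by (intro inv_mod_unique) auto
  then show ?thesis ..
qed

lemma sum_inv_mod: "(\<Sum>s\<in>{1..<p}. inv_mod s) = \<Sum>{1..<p}"
  using sum.reindex_bij_betw[OF bij_inv_mod, of "\<lambda>s. s"] .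

text \<open>The power with exponent \<open>P(sigma)\<close>, indexed by
  \<open>s = v ^ i mod p\<close> instead of \<open>i\<close>.\<close>

definition stickelberger_pow :: "int poly \<Rightarrow> complex" where
  "stickelberger_pow f = (\<Prod>s\<in>{1..<p}. ev f (z ^ s) ^ inv_mod s)"

lemma stickelberger_pow_in_R: "stickelberger_pow f \<in> R"
proof -
  have "ev f (z ^ s) \<in> R" for s
    using ev_in_R[of "pcompose f (monom 1 s)"] by simp
  then show ?thesis by (auto simp: stickelberger_pow_def)
qed

text \<open>Conjugation exchanges \<open>s\<close> and \<open>p - s\<close>, and the exponents
  \<open>inv_mod s\<close> and \<open>p - inv_mod s\<close> add up to \<open>p\<close>.\<close>

lemma stickelberger_pow_mult_cnj: "stickelberger_pow f * cnj (stickelberger_pow f) = (\<Prod>s\<in>{1..<p}. ev f (z ^ s)) ^ p"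
proof -
  have bij: "bij_betw (\<lambda>s. p - s) {1..<p} {1..<p}"
    by (rule bij_betw_byWitness[where f' = "\<lambda>s. p - s"]) auto
  have "cnj (stickelberger_pow f) = (\<Prod>s\<in>{1..<p}. ev f (z ^ (p - s)) ^ inv_mod s)"
    by (simp add: stickelberger_pow_def cnj_ev_z del: cnj_ev)
  also have "\<dots> = (\<Prod>s\<in>{1..<p}. ev f (z ^ (p - (p - s))) ^ inv_mod (p - s))"
    using prod.reindex_bij_betw[OF bij, of "\<lambda>s. ev f (z ^ (p - s)) ^ inv_mod s"] by simp
  also have "\<dots> = (\<Prod>s\<in>{1..<p}. ev f (z ^ s) ^ (p - inv_mod s))"
    by (intro prod.cong refl) (simp add: inv_mod_reflect)
  finally have "stickelberger_pow f * cnj (stickelberger_pow f) = (\<Prod>s\<in>{1..<p}. ev f (z ^ s) ^ inv_mod s * ev f (z ^ s) ^ (p - inv_mod s))"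
    by (simp add: stickelberger_pow_def prod.distrib)
  also have "\<dots> = (\<Prod>s\<in>{1..<p}. ev f (z ^ s) ^ p)"
  proof (intro prod.cong refl)
    fix s assume "s \<in> {1..<p}"
    then have "inv_mod s + (p - inv_mod s) = p" using inv_mod_range[of s] by simp
    then show "ev f (z ^ s) ^ inv_mod s * ev f (z ^ s) ^ (p - inv_mod s) = ev f (z ^ s) ^ p"
      by (metis power_add)
  qed
  finally show ?thesis by (simp add: prod_power_distrib)
qed

lemma P_sigma_pow_ev:
  assumes v: "residue_primroot p v" and n: "n \<noteq> 0"
  shows "P_sigma_pow z p v (ev f z / of_int n) = (\<Prod>s\<in>{1..<p}. (ev f (z ^ s) / of_int n) ^ inv_mod s)"
proof -
  have nv: "\<not> p dvd v"
  proof
    assume "p dvd v"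
    then have "is_unit p" using v by (simp add: residue_primroot_def coprime_absorb_left)
    then show False using p_gt_1 by simp
  qed
  have bij: "bij_betw (\<lambda>i. v ^ i mod p) {..<p - 1} {1..<p}"
  proof -
    have "{0<..<p} = {1..<p}" by auto
    then have "totatives p = {1..<p}" by (simp only: totatives_prime[OF p_prime])
    then show ?thesis
      using residue_primroot_is_generator[OF p_gt_1 v] totient_prime[OF p_prime] by (simp only:)
  qed
  have "{0..p - 2} = {..<p - 1}" using p_ge_3 by auto
  then have "P_sigma_pow z p v (ev f z / of_int n)
      = (\<Prod>i\<in>{..<p - 1}. (ev f (z ^ (v ^ i mod p)) / of_int n) ^ inv_mod (v ^ i mod p))"
    unfolding P_sigma_pow_def gal_aut_funpow_ev[OF nv n]
    by (simp add: power_mod_exponent[OF z_power] vneg_def inv_mod_def power_mod mult.commute flip: power_mult)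
  also have "\<dots> = (\<Prod>s\<in>{1..<p}. (ev f (z ^ s) / of_int n) ^ inv_mod s)"
    using prod.reindex_bij_betw[OF bij, of "\<lambda>s. (ev f (z ^ s) / of_int n) ^ inv_mod s"] .
  finally show ?thesis .
qed

text \<open>The cofactor is the product of the other conjugates, with the sign of \<open>N\<close>
  absorbed. It serves to clear denominators.\<close>

lemma conjugate_cofactor:
  assumes N: "(\<Prod>t\<in>{1..<p}. ev a (z ^ t)) = of_int N"
  obtains b where "\<And>s. \<not> p dvd s \<Longrightarrow> ev (a * b) (z ^ s) = of_int \<bar>N\<bar>" "ev (a * b) z = ev (of_int \<bar>N\<bar>) z"
proof -
  define b where "b = smult (sgn N) (\<Prod>t\<in>{2..<p}. pcompose a (monom 1 t))"
  have "{1..<p} = insert 1 {2..<p}" using p_gt_1 by auto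
  then have "ev a z * (\<Prod>t\<in>{2..<p}. ev a (z ^ t)) = of_int N" using N by simp
  then have "ev (a * b) z = of_int (sgn N * N)" by (simp add: b_def)
  then have *: "ev (a * b) z = ev (of_int \<bar>N\<bar>) z" 
    by (simp only: ev_of_int abs_sgn[of N] mult.commute)
  show ?thesis
  proof (rule that[of b])
    show "ev (a * b) (z ^ s) = of_int \<bar>N\<bar>" if "\<not> p dvd s" for s
      using ev_eq_conj[OF * that] by (simp only: ev_of_int)
  qed (rule *)
qed

text \<open>The action of \<open>gal_aut\<close> is known on quotients by integers, so
  \<open>1 / cnj a\<close> is rewritten as the conjugate of the cofactor \<open>b\<close> over
  \<open>\<bar>N\<bar>\<close>.\<close>

lemma P_sigma_pow_quotient:
  assumes v: "residue_primroot p v" and N: "(\<Prod>t\<in>{1..<p}. ev a (z ^ t)) = of_int N" "N \<noteq> 0"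
  shows "P_sigma_pow z p v (ev a z / cnj (ev a z)) = stickelberger_pow a / cnj (stickelberger_pow a)"
proof -
  obtain b where b: "\<And>s. \<not> p dvd s \<Longrightarrow> ev (a * b) (z ^ s) = of_int \<bar>N\<bar>"
    using conjugate_cofactor[OF N(1)] by metis
  define f where "f = a * pcompose b (monom 1 (p - 1))"
  have *: "ev f (z ^ s) / of_int \<bar>N\<bar> = ev a (z ^ s) / cnj (ev a (z ^ s))" if s: "\<not> p dvd s" for s
  proof -
    have "(z ^ s) ^ (p - 1) = cnj (z ^ s)"
      using cnj_root_of_unity(1)[of "z ^ s" p] by simp
    then have "ev f (z ^ s) = ev a (z ^ s) * cnj (ev b (z ^ s))"
      by (simp add: f_def cnj_ev)
    moreover have "cnj (ev a (z ^ s)) * cnj (ev b (z ^ s)) = of_int \<bar>N\<bar>"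
      using arg_cong[OF b[OF s], of cnj] by simp
    ultimately show ?thesis using N(2)
      by (simp add: divide_simps) (metis mult.commute mult.assoc mult_zero_left of_int_eq_0_iff abs_eq_0)
  qed
  have "ev a z / cnj (ev a z) = ev f z / of_int \<bar>N\<bar>"
    using *[of 1] p_gt_1 by simp
  then have "P_sigma_pow z p v (ev a z / cnj (ev a z)) = (\<Prod>s\<in>{1..<p}. (ev f (z ^ s) / of_int \<bar>N\<bar>) ^ inv_mod s)"
    using P_sigma_pow_ev[OF v, of "\<bar>N\<bar>" f] N(2) by simp
  also have "\<dots> = (\<Prod>s\<in>{1..<p}. (ev a (z ^ s) / cnj (ev a (z ^ s))) ^ inv_mod s)"
    using * not_dvd_range by (intro prod.cong refl) metis
  also have "\<dots> = stickelberger_pow a / cnj (stickelberger_pow a)"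
    by (simp add: stickelberger_pow_def power_divide prod_dividef)
  finally show ?thesis .
qed

text \<open>Each \<open>z ^ s - 1\<close> is a multiple of \<open>lam\<close>, so the congruence
  modulo \<open>lam\<^sup>2\<close> passes to every conjugate.\<close>

lemma stickelberger_pow_cong_1:
  assumes "congR (lam\<^sup>2) (ev a z) 1"
  shows "congR (lam\<^sup>2) (stickelberger_pow a) 1"
proof -
  obtain g where "ev a z - 1 = lam\<^sup>2 * ev g z"
    using assms unfolding congR_def by (metis cyc_int_iff)
  then have "ev (a - 1) z = ev ([:-1, 1:]\<^sup>2 * g) z" by (simp add: algebra_simps)
  then have ag: "ev (a - 1) (z ^ s) = ev ([:-1, 1:]\<^sup>2 * g) (z ^ s)" if "\<not> p dvd s" for s
    using that by (rule ev_eq_conj)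
  have inR: "ev f (z ^ s) \<in> R" for f s
    using ev_in_R[of "pcompose f (monom 1 s)"] by simp
  have c: "congR (lam\<^sup>2) (ev a (z ^ s)) 1" if s: "s \<in> {1..<p}" for s
  proof -
    obtain c where c: "c \<in> R" "z ^ s - 1 = lam * c" using z_power_minus_1 by blast
    have "ev a (z ^ s) - 1 = (z ^ s - 1)\<^sup>2 * ev g (z ^ s)"
      using ag[OF not_dvd_range[OF s]] by simp
    also have "\<dots> = lam\<^sup>2 * (c\<^sup>2 * ev g (z ^ s))" by (simp only: c(2) power_mult_distrib mult.assoc)
    finally show ?thesis unfolding congR_def using c inR by blast
  qed
  have "congR (lam\<^sup>2) (stickelberger_pow a) (\<Prod>s\<in>{1..<p}. 1 ^ inv_mod s)"
    unfolding stickelberger_pow_def by (intro congR_prod congR_power c inR R_power R_1)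
  then show ?thesis by simp
qed

end

section \<open>The power of the Gauss sum as a Stickelberger power\<close>

context gauss_setup begin

text \<open>With the cofactor \<open>b\<close> of \<open>a\<close>, the Stickelberger powers of
  \<open>a\<close> and \<open>b\<close> multiply to \<open>l ^ M\<close>, which explains the choice
  of \<open>M\<close>. Integrality of the quotient by the power of \<open>a\<close> thus becomes
  divisibility by \<open>l ^ M\<close> of the product with the power of \<open>b\<close>.\<close>

theorem gauss_sum_power_eq:
  assumes N: "(\<Prod>t\<in>{1..<p}. ev a (z ^ t)) = of_int N" "\<bar>N\<bar> = int l ^ p"
    and cop: "\<And>t. t \<in> {2..<p} \<Longrightarrow> coprime (poly a (int k ^ t)) (int l)"
    and M: "M = p * \<Sum>{1..<p}"
    and cong: "congR (lam\<^sup>2) (ev a z) 1"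
  shows "G (z ^ (p - 1)) ^ p\<^sup>2 = - stickelberger_pow a"
proof -
  define S where "S = \<Sum>{1..<p}"
  have M': "M = p * S" using M by (simp add: S_def)
  have l0: "l > 0" using l_gt_p by simp
  obtain b where b: "\<And>s. \<not> p dvd s \<Longrightarrow> ev (a * b) (z ^ s) = of_int \<bar>N\<bar>" "ev (a * b) z = ev (of_int \<bar>N\<bar>) z"
    using conjugate_cofactor[OF N(1)] by metis
  have Mp: "p \<le> M"
  proof -
    have "1 \<in> {1..<p}" using p_gt_1 by simp
    then have "1 \<le> S" unfolding S_def by (intro member_le_sum) auto
    then show ?thesis by (simp add: M')
  qed
  \<comment> \<open>Away from \<open>t = 1\<close> the value of \<open>a\<close> is prime to
    \<open>l\<close>, so the whole norm \<open>l ^ p\<close> is contributed by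
    \<open>b\<close>.\<close>
  have b_dvd: "int l ^ p dvd poly b (int k ^ t)" if t: "\<not> p dvd t" "\<not> [t = 1] (mod p)" for t
  proof -
    have t': "t mod p \<in> {2..<p}"
    proof -
      have "t mod p \<noteq> 0" using t by (simp add: dvd_eq_mod_eq_0)
      moreover have "t mod p \<noteq> 1" using t p_gt_1 by (simp add: cong_def)
      ultimately show ?thesis by auto
    qed
    have "[poly a (int k ^ t) = poly a (int k ^ (t mod p))] (mod int l ^ M)"
      by (rule poly_cong_exponent) (simp add: cong_def)
    then have "[poly a (int k ^ t) = poly a (int k ^ (t mod p))] (mod int l)"
      using M_pos by (meson cong_dvd_modulus dvd_power)
    then have ca: "coprime (poly a (int k ^ t)) (int l)"
      using cop[OF t'] by (metis cong_imp_coprime cong_sym)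
    have "[poly (a * b) (int k ^ t) = poly (of_int \<bar>N\<bar>) (int k ^ t)] (mod int l ^ M)"
      using b(2) t(1) by (rule poly_cong_at_k)
    then have "[poly a (int k ^ t) * poly b (int k ^ t) = int l ^ p] (mod int l ^ M)"
      by (simp add: N(2) of_int_poly)
    then have "[poly a (int k ^ t) * poly b (int k ^ t) = int l ^ p] (mod int l ^ p)"
      using Mp by (meson cong_dvd_modulus le_imp_power_dvd)
    then have "int l ^ p dvd poly a (int k ^ t) * poly b (int k ^ t)"
      by (simp add: cong_def dvd_eq_mod_eq_0)
    moreover have "coprime (int l ^ p) (poly a (int k ^ t))" using ca by (simp add: coprime_commute)
    ultimately show ?thesis by (simp add: coprime_dvd_mult_right_iff)
  qed
  define BP where "BP = (\<Prod>s\<in>{1..<p}. pcompose b (monom 1 s) ^ inv_mod s)"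
  define F where "F = pcompose gauss_poly (monom 1 (p - 1)) ^ p * BP"
  have "int l ^ M dvd poly F (int k ^ s)" if s: "s \<in> {1..<p}" for s
  proof -
    have ivs: "inv_mod s \<in> {1..<p}" using inv_mod_range[OF s] .
    have sS: "s \<le> S" unfolding S_def using s by (intro member_le_sum) auto
    have "(int l ^ s) ^ p dvd poly gauss_poly (int k ^ ((p - 1) * s)) ^ p"
      by (intro dvd_power_same gauss_poly_dvd s)
    moreover have "int l ^ (p * (S - s)) dvd poly BP (int k ^ s)"
    proof -
      \<comment> \<open>At \<open>k ^ s\<close> the factor of \<open>BP\<close> with index
        \<open>t\<close> is evaluated at \<open>k ^ (s * t)\<close>. Only
        \<open>t = inv_mod s\<close>, which carries the exponent \<open>s\<close>, may lack its
        power of \<open>l\<close>; the Gauss sum supplies the missing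
        \<open>l ^ (p * s)\<close>.\<close>
      have "S = s + (\<Sum>t\<in>{1..<p} - {inv_mod s}. inv_mod t)"
        using sum.remove[OF _ ivs, of inv_mod] inv_mod_iv[OF s] sum_inv_mod by (simp add: S_def)
      then have "int l ^ (p * (S - s)) = (\<Prod>t\<in>{1..<p} - {inv_mod s}. (int l ^ p) ^ inv_mod t)"
        by (simp add: power_mult power_sum)
      also have "\<dots> dvd (\<Prod>t\<in>{1..<p} - {inv_mod s}. poly b (int k ^ (s * t)) ^ inv_mod t)"
      proof (intro prod_dvd_prod dvd_power_same b_dvd)
        fix t assume t: "t \<in> {1..<p} - {inv_mod s}"
        show "\<not> p dvd s * t"
          using t not_dvd_range[OF s] not_dvd_range[of t] p_prime by (simp add: prime_dvd_mult_iff)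
        show "\<not> [s * t = 1] (mod p)" using inv_mod_unique[OF s] t by blast
      qed
      also have "\<dots> dvd (\<Prod>t\<in>{1..<p}. poly b (int k ^ (s * t)) ^ inv_mod t)"
        by (intro prod_dvd_prod_subset) auto
      also have "\<dots> = poly BP (int k ^ s)"
        by (simp add: BP_def poly_prod poly_pcompose poly_monom power_mult)
      finally show ?thesis .
    qed
    ultimately have "(int l ^ s) ^ p * int l ^ (p * (S - s))
        dvd poly gauss_poly (int k ^ ((p - 1) * s)) ^ p * poly BP (int k ^ s)"
      by (rule mult_dvd_mono)
    moreover have "(int l ^ s) ^ p * int l ^ (p * (S - s)) = int l ^ M"
      using sS by (simp add: M' diff_mult_distrib2 mult.commute flip: power_mult power_add)
    moreover have "poly F (int k ^ s) = poly gauss_poly (int k ^ ((p - 1) * s)) ^ p * poly BP (int k ^ s)"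
      by (simp add: F_def poly_pcompose poly_monom mult.commute flip: power_mult)
    ultimately show ?thesis by simp
  qed
  then obtain h where h: "ev F z = of_nat (l ^ M) * ev h z"
    using divisible_if_conjugates_divisible[of F] by blast
  define u where "u = ev h z"
  have np: "\<not> p dvd p - 1" using p_ge_3 by (intro not_dvd_range) auto
  have g: "ev gauss_poly (z ^ (p - 1)) = G (z ^ (p - 1)) ^ p"
    by (rule ev_gauss_poly[OF np])
  have "stickelberger_pow a * ev BP z = (\<Prod>s\<in>{1..<p}. (of_nat (l ^ p)) ^ inv_mod s)"
    unfolding stickelberger_pow_def BP_def ev_prod prod.distrib[symmetric]
  proof (intro prod.cong refl)
    fix s assume "s \<in> {1..<p}"
    then show "ev a (z ^ s) ^ inv_mod s * ev (pcompose b (monom 1 s) ^ inv_mod s) z = of_nat (l ^ p) ^ inv_mod s"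
      using b(1)[OF not_dvd_range] N(2) by (simp flip: power_mult_distrib)
  qed
  also have "\<dots> = of_nat (l ^ p) ^ (\<Sum>s\<in>{1..<p}. inv_mod s)" by (simp only: power_sum)
  also have "\<dots> = of_nat (l ^ M)" by (simp only: sum_inv_mod M power_mult of_nat_power)
  finally have aB: "stickelberger_pow a * ev BP z = of_nat (l ^ M)" .
  have "ev F z = G (z ^ (p - 1)) ^ p\<^sup>2 * ev BP z"
    by (simp add: F_def g[simplified] power2_eq_square power_mult)
  then have "G (z ^ (p - 1)) ^ p\<^sup>2 * (stickelberger_pow a * ev BP z) = of_nat (l ^ M) * (u * stickelberger_pow a)"
    using h by (simp add: u_def mult_ac)
  then have Gu: "G (z ^ (p - 1)) ^ p\<^sup>2 = u * stickelberger_pow a"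
    using l0 unfolding aB by simp
  \<comment> \<open>Both the Gauss sum power and the Stickelberger power have squared absolute value
    \<open>l ^ p\<^sup>2\<close>.\<close>
  have "norm u = 1"
  proof -
    have "norm (G (z ^ (p - 1))) ^ 2 = real l"
    proof -
      have "G (z ^ (p - 1)) * cnj (G (z ^ (p - 1))) = of_nat l"
        using np z_power_neq_1 by (intro norm_G_sq) auto
      then have "complex_of_real (norm (G (z ^ (p - 1))) ^ 2) = of_real (real l)"
        by (simp only: complex_norm_square of_real_of_nat_eq)
      then show ?thesis by (simp only: of_real_eq_iff)
    qed
    moreover have "norm (G (z ^ (p - 1)) ^ n) ^ 2 = (norm (G (z ^ (p - 1))) ^ 2) ^ n" for n
      by (simp add: norm_power mult.commute flip: power_mult)
    ultimately have nG: "norm (G (z ^ (p - 1)) ^ p\<^sup>2) ^ 2 = real l ^ p\<^sup>2" by simp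
    have "norm (stickelberger_pow a) ^ 2 = norm (stickelberger_pow a * cnj (stickelberger_pow a))"
      by (simp add: norm_mult power2_eq_square)
    also have "\<dots> = norm (of_int N :: complex) ^ p"
      unfolding stickelberger_pow_mult_cnj N(1) by (simp add: norm_power)
    also have "norm (of_int N :: complex) = real l ^ p"
      using arg_cong[OF N(2), of real_of_int] by simp
    finally have nS: "norm (stickelberger_pow a) ^ 2 = real l ^ p\<^sup>2"
      by (simp add: power2_eq_square power_mult)
    have "norm u ^ 2 * real l ^ p\<^sup>2 = real l ^ p\<^sup>2"
      using nG nS unfolding Gu by (simp add: norm_mult power_mult_distrib)
    then have "norm u ^ 2 = 1" using l0 by simp
    then show ?thesis by (simp add: power2_eq_1_iff) (smt (verit) norm_ge_zero)
  qed
  moreover have "congR (lam\<^sup>2) (- u) 1"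
  proof -
    have uR: "u \<in> R" by (simp add: u_def)
    have gR: "ev gauss_poly (z ^ (p - 1)) \<in> R"
      using ev_in_R[of "pcompose gauss_poly (monom 1 (p - 1))"] by simp
    have "congR (lam\<^sup>2) (ev gauss_poly (z ^ (p - 1)) ^ p) ((-1) ^ p)"
      using gR by (intro congR_power G_power_p_cong np) auto
    then have 1: "congR (lam\<^sup>2) (u * stickelberger_pow a) (-1)"
      using p_odd Gu[symmetric] by (simp only: g power2_eq_square power_mult) simp
    have "congR (lam\<^sup>2) (u * stickelberger_pow a) (u * 1)"
      using uR stickelberger_pow_in_R by (intro congR_mult stickelberger_pow_cong_1 cong) auto
    from congR_sym[OF this] have "congR (lam\<^sup>2) u (u * stickelberger_pow a)" by simp
    from congR_trans[OF this 1] have "congR (lam\<^sup>2) u (-1)" .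
    then have "congR (lam\<^sup>2) (u * -1) (-1 * -1)" by (intro congR_mult) auto
    then show ?thesis by simp
  qed
  ultimately have "- u = 1" by (intro unit_circle_cong_1) (auto simp: u_def)
  then have "u = -1" by (metis add.inverse_inverse)
  then show ?thesis using Gu by simp
qed

end

section \<open>Prime ideals of degree one\<close>

text \<open>In \<open>y ^ l - 1 = (y - 1) * (1 + y + ... + y ^ (l - 1))\<close> the second factor is
  divisible by \<open>l\<close> when \<open>y\<close> is 1 modulo \<open>l\<close>, so each
  \<open>l\<close>-th power gains one factor \<open>l\<close>.\<close>

lemma lift_cong_1_prime_power:
  fixes x :: int
  assumes "[x = 1] (mod int l)"
  shows "[x ^ (l ^ n) = 1] (mod int l ^ Suc n)"
proof (induction n)
  case (Suc n)
  define y where "y = x ^ (l ^ n)"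
  have "[y = 1] (mod int l)"
    using Suc unfolding y_def by (rule cong_dvd_modulus) simp
  then have "[poly (cyclotomic_prime l) y = poly (cyclotomic_prime l) 1] (mod int l)"
    by (rule cong_poly)
  then have "int l dvd poly (cyclotomic_prime l) y"
    by (simp add: poly_cyclotomic_prime_1 cong_def dvd_eq_mod_eq_0)
  moreover have "int l ^ Suc n dvd y - 1"
    using Suc by (simp add: y_def cong_iff_dvd_diff)
  ultimately have "int l ^ Suc n * int l dvd (y - 1) * poly (cyclotomic_prime l) y"
    by (intro mult_dvd_mono)
  also have "\<dots> = y ^ l - 1" by (rule poly_cyclotomic_prime_mult)
  also have "y ^ l = x ^ (l ^ Suc n)" by (simp add: y_def mult.commute flip: power_mult)
  finally show ?case by (simp add: cong_iff_dvd_diff mult.commute)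
qed (use assms in simp)

lemma prime_power_power_cong:
  fixes a l :: nat
  assumes "prime l"
  shows "[a ^ (l ^ n) = a] (mod l)"
proof (cases "l dvd a")
  case True
  have "l ^ n \<noteq> 0" using assms by (simp add: prime_gt_0_nat)
  then have "l dvd a ^ (l ^ n)" using True by (meson dvd_power dvd_trans bot_nat_0.not_eq_extremum)
  then show ?thesis using True by (simp add: cong_def dvd_eq_mod_eq_0)
next
  case False
  show ?thesis
  proof (induction n)
    case (Suc n)
    have "[(a ^ (l ^ n)) ^ l = a ^ l] (mod l)" using Suc by (rule cong_pow)
    also have "a ^ l = a * a ^ (l - 1)"
      using prime_gt_0_nat[OF assms] by (simp add: power_eq_if)
    also have "[\<dots> = a * 1] (mod l)"
      by (intro cong_mult cong_refl fermat_theorem assms False)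
    finally show ?case by (simp add: mult.commute flip: power_mult)
  qed simp
qed

locale degree_one_prime = prime_cyclotomic +
  fixes l :: nat and Q :: "complex set"
  assumes Q_prime: "prime_ideal (cyc_int z p) Q" and Q_nonprincipal: "\<not> is_principal (cyc_int z p) Q"
    and l_prime: "prime l" and l_in_Q: "of_nat l \<in> Q"
    and Q_degree: "\<And>x. x \<in> cyc_int z p \<Longrightarrow> \<exists>k::int. x - of_int k \<in> Q"
begin

lemma Q_ideal: "is_ideal R Q" using Q_prime by (simp add: prime_ideal_def)

lemma Q_in_R: "x \<in> Q \<Longrightarrow> x \<in> R" using Q_ideal by (auto simp: is_ideal_def)
lemma Q_add: "x \<in> Q \<Longrightarrow> y \<in> Q \<Longrightarrow> x + y \<in> Q" using Q_ideal by (auto simp: is_ideal_def)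
lemma Q_uminus: "x \<in> Q \<Longrightarrow> - x \<in> Q" using Q_ideal by (auto simp: is_ideal_def)
lemma Q_mult: "r \<in> R \<Longrightarrow> x \<in> Q \<Longrightarrow> r * x \<in> Q" using Q_ideal by (auto simp: is_ideal_def)
lemma Q_diff: "x \<in> Q \<Longrightarrow> y \<in> Q \<Longrightarrow> x - y \<in> Q" using Q_add[OF _ Q_uminus, of x y] by simp

lemma one_notin_Q: "1 \<notin> Q"
proof
  assume "1 \<in> Q"
  then have "R \<subseteq> Q" using Q_mult[of _ 1] by auto
  then show False using Q_prime Q_in_R by (auto simp: prime_ideal_def)
qed

lemma of_int_in_Q_iff: "of_int n \<in> Q \<longleftrightarrow> int l dvd n"
proof
  assume "int l dvd n"
  then obtain j where "n = int l * j" ..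
  then show "of_int n \<in> Q" using Q_mult[OF R_of_int[of j] l_in_Q] by (simp add: mult.commute)
next
  assume n: "of_int n \<in> Q"
  show "int l dvd n"
  proof (rule ccontr)
    assume "\<not> int l dvd n"
    then have "coprime (int l) n" using l_prime by (intro prime_imp_coprime) auto
    then obtain a b where "a * int l + b * n = 1" by (metis bezout_int coprime_imp_gcd_eq_1)
    then have "of_int a * of_nat l + of_int b * of_int n = (1 :: complex)"
      by (metis of_int_1 of_int_add of_int_mult of_int_of_nat_eq)
    moreover have "of_int a * of_nat l + of_int b * of_int n \<in> Q"
      by (intro Q_add Q_mult n l_in_Q R_of_int)
    ultimately show False using one_notin_Q by simp
  qed
qed

lemma ev_minus_poly_in_Q:
  assumes "z - of_int c \<in> Q"
  shows "ev f z - of_int (poly f c) \<in> Q"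
proof (induction f)
  case 0
  then show ?case using Q_ideal by (simp add: is_ideal_def)
next
  case (pCons a f)
  have "ev (pCons a f) z - of_int (poly (pCons a f) c)
      = z * (ev f z - of_int (poly f c)) + of_int (poly f c) * (z - of_int c)"
    by (simp add: algebra_simps)
  then show ?case using Q_add[OF Q_mult[OF z_in_R pCons.IH] Q_mult[OF R_of_int assms]] by simp
qed

text \<open>Reduction modulo \<open>Q\<close> is evaluation at \<open>c\<close> modulo
  \<open>l\<close>.\<close>

lemma ev_in_Q_iff: "z - of_int c \<in> Q \<Longrightarrow> ev f z \<in> Q \<longleftrightarrow> int l dvd poly f c"
proof -
  assume c: "z - of_int c \<in> Q"
  have d: "ev f z - of_int (poly f c) \<in> Q" using c by (rule ev_minus_poly_in_Q)
  show ?thesis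
    unfolding of_int_in_Q_iff[symmetric]
    using Q_add[OF d, of "of_int (poly f c)"] Q_diff[OF _ d, of "ev f z"] by auto
qed

text \<open>If \<open>lam\<close> were in \<open>Q\<close>, then \<open>l = p\<close> and
  \<open>Q\<close> would be generated by \<open>lam\<close>, against the assumption that it is not
  principal.\<close>

lemma lam_notin_Q: "lam \<notin> Q"
proof
  assume lam: "lam \<in> Q"
  then have 1: "z - of_int 1 \<in> Q" by simp
  have "ev (cyclotomic_prime p) z \<in> Q"
    using Q_ideal by (simp add: ev_cyclotomic_prime[OF z_power z_neq_1] is_ideal_def)
  then have "int l dvd int p" by (simp only: ev_in_Q_iff[OF 1] poly_cyclotomic_prime_1)
  then have lp: "l = p" using p_prime l_prime by (simp add: primes_dvd_imp_eq)
  have "Q = principal R lam"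
  proof
    show "Q \<subseteq> principal R lam"
    proof
      fix x assume x: "x \<in> Q"
      then obtain f where f: "x = ev f z" using Q_in_R cyc_int_iff by blast
      obtain c where c: "c \<in> R" "x - of_int (poly f 1) = lam * c"
        using ev_congR_lam[of f] f by (auto simp: congR_def)
      have "int p dvd poly f 1" using x ev_in_Q_iff[OF 1, of f] f lp by simp
      then obtain j where j: "poly f 1 = int p * j" ..
      obtain d where d: "d \<in> R" "of_nat p = lam * d" by (rule p_multiple_of_lam)
      have "x = lam * c + of_int (poly f 1)" using c(2) by (metis diff_add_cancel)
      also have "\<dots> = lam * (c + d * of_int j)" by (simp only: j of_int_mult of_int_of_nat_eq d(2) distrib_left mult.assoc)
      finally show "x \<in> principal R lam" unfolding principal_def using c d by auto
    qed
    show "principal R lam \<subseteq> Q"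
    proof
      fix x assume "x \<in> principal R lam"
      then obtain r where "r \<in> R" "x = r * lam" by (auto simp: principal_def mult.commute)
      then show "x \<in> Q" using Q_mult lam by simp
    qed
  qed
  then show False using Q_nonprincipal by (auto simp: is_principal_def)
qed

text \<open>An integer congruent to \<open>z\<close> modulo \<open>Q\<close> is a
  \<open>p\<close>-th root of 1 modulo \<open>l\<close>. Its power with exponent
  \<open>l ^ (M - 1)\<close>, a Teichmueller lift, is one modulo \<open>l ^ M\<close> in the same
  residue class.\<close>

lemma split_prime_exists:
  assumes "M > 0"
  obtains k where "split_prime p z l M k" "z - of_int (int k) \<in> Q"
proof -
  obtain k1 :: int where k1: "z - of_int k1 \<in> Q" using Q_degree[OF z_in_R] by blast
  define k0 where "k0 = nat (k1 mod int l)"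
  have l0: "l > 0" using l_prime prime_gt_0_nat by blast
  have shift: "z - of_int c' \<in> Q" if "z - of_int c \<in> Q" "[c = c'] (mod int l)" for c c'
  proof -
    have "of_int (c - c') \<in> Q" using that(2) by (simp only: of_int_in_Q_iff cong_iff_dvd_diff)
    then show ?thesis using Q_add[OF that(1), of "of_int (c - c')"] by simp
  qed
  have k0: "z - of_int (int k0) \<in> Q"
    using k1 by (rule shift) (use l0 in \<open>simp add: k0_def cong_def\<close>)
  have "ev (monom 1 p - 1) z \<in> Q"
    using Q_ideal by (simp add: z_power is_ideal_def)
  then have "[int k0 ^ p = 1] (mod int l)"
    unfolding ev_in_Q_iff[OF k0] by (simp add: poly_monom cong_iff_dvd_diff)
  then have "[(int k0 ^ p) ^ (l ^ (M - 1)) = 1] (mod int l ^ Suc (M - 1))"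
    by (rule lift_cong_1_prime_power)
  then have root: "[int ((k0 ^ (l ^ (M - 1))) ^ p) = int 1] (mod int (l ^ M))"
    using assms by (simp add: mult.commute flip: power_mult)
  define k where "k = k0 ^ (l ^ (M - 1))"
  have kk0: "[k = k0] (mod l)" unfolding k_def by (rule prime_power_power_cong[OF l_prime])
  have kQ: "z - of_int (int k) \<in> Q"
    using k0 by (rule shift) (use kk0 cong_sym in \<open>simp add: cong_int_iff\<close>)
  have "[k \<noteq> 1] (mod l)"
  proof
    assume "[k = 1] (mod l)"
    then have "[int k = 1] (mod int l)" by (metis cong_int_iff of_nat_1)
    then have "z - of_int 1 \<in> Q" using shift[OF kQ] by blast
    then show False using lam_notin_Q by simp
  qed
  moreover have "[k ^ p = 1] (mod l ^ M)"
    using root unfolding k_def by (simp only: cong_int_iff)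
  ultimately have "split_prime p z l M k"
    using assms l_prime by unfold_locales auto
  then show ?thesis using kQ that by blast
qed

lemma power_in_ideal_pow: "x \<in> Q \<Longrightarrow> x ^ n \<in> ideal_pow R Q n"
  by (induction n) (auto simp: ideal_prod_def)

text \<open>The right-hand side is an ideal containing the required products, and
  \<open>ideal_prod\<close> is the least such ideal. Only some representative \<open>f\<close> is
  asked for, as another may have a different value at \<open>k\<close> modulo
  \<open>l ^ n\<close>.\<close>

lemma ideal_pow_subset:
  assumes k: "z - of_int (int k) \<in> Q"
  shows "ideal_pow R Q n \<subseteq> {ev f z | f. int l ^ n dvd poly f (int k)}"
proof (induction n)
  case 0
  then show ?case by (auto simp: cyc_int_iff)
next
  case (Suc n)
  let ?V = "{ev f z | f. int l ^ Suc n dvd poly f (int k)}"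
  have "is_ideal R ?V"
    unfolding is_ideal_def
  proof (intro conjI ballI)
    show "?V \<subseteq> R" by auto
    show "0 \<in> ?V" by (intro CollectI exI[of _ 0]) simp
  next
    fix x y assume "x \<in> ?V" "y \<in> ?V"
    then obtain f g where fg: "x = ev f z" "int l ^ Suc n dvd poly f (int k)" "y = ev g z" "int l ^ Suc n dvd poly g (int k)"
      by auto
    show "x + y \<in> ?V" using fg by (intro CollectI exI[of _ "f + g"]) (simp add: dvd_add)
    show "- x \<in> ?V" using fg by (intro CollectI exI[of _ "- f"]) simp
  next
    fix r x assume "r \<in> R" "x \<in> ?V"
    then obtain f g where fg: "x = ev f z" "int l ^ Suc n dvd poly f (int k)" "r = ev g z"
      by (auto simp: cyc_int_iff)
    then show "r * x \<in> ?V" by (intro CollectI exI[of _ "g * f"]) (simp add: dvd_mult)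
  qed
  moreover have "{a * b |a b. a \<in> Q \<and> b \<in> ideal_pow R Q n} \<subseteq> ?V"
  proof safe
    fix a b assume a: "a \<in> Q" and b: "b \<in> ideal_pow R Q n"
    obtain f where f: "a = ev f z" using a Q_in_R cyc_int_iff by blast
    then have fd: "int l dvd poly f (int k)" using a ev_in_Q_iff[OF k] by simp
    obtain g where g: "b = ev g z" "int l ^ n dvd poly g (int k)" using b Suc by blast
    have "int l * int l ^ n dvd poly f (int k) * poly g (int k)" using fd g(2) by (rule mult_dvd_mono)
    then show "\<exists>h. a * b = ev h z \<and> int l ^ Suc n dvd poly h (int k)"
      using f g by (intro exI[of _ "f * g"]) simp
  qed
  ultimately show ?case by (auto simp: ideal_prod_def)
qed

end

section \<open>The Gauss sum of \<open>Q\<close> and the generator of its \<open>p\<close>-th power,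
  read off at \<open>k\<close>\<close>

locale degree_one_gauss = degree_one_prime + gauss_setup +
  assumes k_in_Q: "z - of_int (int k) \<in> Q"
begin

lemma power_res_eq:
  assumes x: "x \<in> {1..<l}"
  shows "power_res z p l Q (int x) = z ^ ind x"
proof -
  have nd: "\<not> l dvd x" using x by (rule l_not_dvd)
  have iff: "of_int (int x) ^ ((l - 1) div p) - z ^ i \<in> Q \<longleftrightarrow> [x ^ ((l - 1) div p) = k ^ i] (mod l)" for i
  proof -
    have "of_int (int x) ^ ((l - 1) div p) - z ^ i = ev (of_int (int x) ^ ((l - 1) div p) - monom 1 i) z"
      by (simp only: ev_diff ev_power ev_of_int ev_monom) simp
    also have "\<dots> \<in> Q \<longleftrightarrow> int l dvd int (x ^ ((l - 1) div p)) - int (k ^ i)"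
      unfolding ev_in_Q_iff[OF k_in_Q] by (simp add: poly_monom of_int_poly of_nat_poly)
    also have "\<dots> \<longleftrightarrow> [x ^ ((l - 1) div p) = k ^ i] (mod l)"
      by (simp only: cong_iff_dvd_diff[symmetric] cong_int_iff)
    finally show ?thesis .
  qed
  show ?thesis
    unfolding power_res_def
  proof (rule the_equality)
    show "(\<exists>i<p. z ^ ind x = z ^ i) \<and> of_int (int x) ^ ((l - 1) div p) - z ^ ind x \<in> Q"
      unfolding iff using ind_works[OF nd] by blast
    fix w assume "(\<exists>i<p. w = z ^ i) \<and> of_int (int x) ^ ((l - 1) div p) - w \<in> Q"
    then obtain i where i: "i < p" "w = z ^ i" "of_int (int x) ^ ((l - 1) div p) - z ^ i \<in> Q" by blast
    then have "ind x = i" unfolding iff using ind_unique[OF nd] by blast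
    then show "w = z ^ ind x" using i by simp
  qed
qed

text \<open>The inverse in the character of \<open>gauss_sum\<close> makes
  \<open>z ^ (p - 1)\<close>, the inverse of \<open>z\<close>, the relevant root of unity.\<close>

lemma gauss_sum_eq_G: "gauss_sum z p zq l Q = G (z ^ (p - 1))"
proof -
  have "z ^ (p - 1) = inverse z"
    using cnj_root_of_unity[OF z_power] by simp
  then show ?thesis
    unfolding gauss_sum_def G_def by (intro sum.cong refl) (simp only: power_res_eq power_inverse)
qed

text \<open>Two elements of \<open>Q ^ p\<close> suffice: \<open>l ^ p\<close> makes the norm a
  power of \<open>l\<close> up to sign, and \<open>(z - k) ^ p\<close> makes \<open>a\<close> prime
  to \<open>l\<close> at \<open>k ^ t\<close> for \<open>t > 1\<close>. The exponent is then the
  exact power of \<open>l\<close> in \<open>a(k)\<close>, visible because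
  \<open>M > p\<close>.\<close>

lemma generator_norm:
  assumes A: "A \<in> R" "principal R A = ideal_pow R Q p" and M: "p < M"
  obtains a N where "A = ev a z" "(\<Prod>t\<in>{1..<p}. ev a (z ^ t)) = of_int N" "\<bar>N\<bar> = int l ^ p"
    "\<And>t. t \<in> {2..<p} \<Longrightarrow> coprime (poly a (int k ^ t)) (int l)"
proof -
  have "A \<in> principal R A" unfolding principal_def by (auto intro: exI[of _ 1])
  then obtain a where a: "A = ev a z" "int l ^ p dvd poly a (int k)"
    using ideal_pow_subset[OF k_in_Q, of p] A(2) by blast
  have factor: "\<exists>f. x ^ p = A * ev f z" if "x \<in> Q" for x
    using power_in_ideal_pow[OF that, of p] unfolding A(2)[symmetric] principal_def cyc_int_iff by blast
  obtain b where "(of_nat l) ^ p = A * ev b z" using factor[OF l_in_Q] by blast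
  then have b: "ev (a * b) z = ev (of_int (int l ^ p)) z"
    using a(1) by (simp only: ev_mult ev_of_int) simp
  obtain c where "(z - of_int (int k)) ^ p = A * ev c z" using factor[OF k_in_Q] by blast
  then have c: "ev (a * c) z = ev ((monom 1 1 - of_int (int k)) ^ p) z"
    using a(1) by (simp only: ev_mult ev_power ev_diff ev_monom ev_of_int) simp
  have lM: "int l dvd int l ^ M" using M_pos by simp
  have pl: "prime (int l)" using l_prime by simp
  have cop: "coprime (poly a (int k ^ t)) (int l)" if t: "t \<in> {2..<p}" for t
  proof -
    have nd: "\<not> p dvd t" using t by (intro not_dvd_range) auto
    have "[poly (a * c) (int k ^ t) = poly ((monom 1 1 - of_int (int k)) ^ p) (int k ^ t)] (mod int l ^ M)"
      by (rule poly_cong_at_k[OF c nd])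
    then have *: "[poly a (int k ^ t) * poly c (int k ^ t) = (int k ^ t - int k) ^ p] (mod int l)"
      using lM by (simp add: poly_monom of_nat_poly cong_dvd_modulus)
    have "\<not> int l dvd poly a (int k ^ t)"
    proof
      assume "int l dvd poly a (int k ^ t)"
      then have "int l dvd (int k ^ t - int k) ^ p"
        using cong_dvd_iff[OF *] by simp
      then have "int l dvd int k ^ t - int k" by (rule prime_dvd_power[OF pl])
      then have "int l dvd int (k ^ t) - int (k ^ 1)" by simp
      then have "[k ^ t = k ^ 1] (mod l)" by (simp only: cong_iff_dvd_diff[symmetric] cong_int_iff)
      then have "[t = 1] (mod p)" unfolding k_power_cong_iff .
      then show False using t by (simp add: cong_def)
    qed
    then show ?thesis using pl by (metis coprime_commute prime_imp_coprime)
  qed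
  obtain N where N: "(\<Prod>t\<in>{1..<p}. ev a (z ^ t)) = of_int N" by (rule norm_is_int)
  obtain N' where N': "(\<Prod>t\<in>{1..<p}. ev b (z ^ t)) = of_int N'" by (rule norm_is_int)
  have "of_int (N * N') = (\<Prod>t\<in>{1..<p}. ev (a * b) (z ^ t))"
    by (simp add: N[symmetric] N'[symmetric] prod.distrib)
  also have "\<dots> = (\<Prod>t\<in>{1..<p}. of_int (int l ^ p))"
    by (intro prod.cong refl) (use ev_eq_conj[OF b not_dvd_range] in \<open>simp only: ev_of_int\<close>)
  also have "\<dots> = of_int ((int l ^ p) ^ (p - 1))" by simp
  finally have "N * N' = (int l ^ p) ^ (p - 1)" by (simp only: of_int_eq_iff)
  then have "N dvd int l ^ (p * (p - 1))" by (metis dvd_triv_left power_mult)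
  then have "nat \<bar>N\<bar> dvd l ^ (p * (p - 1))" by (simp add: nat_abs_dvd_iff)
  then obtain j where "nat \<bar>N\<bar> = l ^ j" using divides_primepow_nat[OF l_prime] by blast
  then have j: "\<bar>N\<bar> = int l ^ j" by (metis abs_ge_zero nat_0_le of_nat_power)
  define F where "F = (\<Prod>t\<in>{1..<p}. pcompose a (monom 1 t))"
  have "ev F z = ev (of_int N) z" using N by (simp add: F_def)
  then have "[poly F (int k ^ 1) = poly (of_int N) (int k ^ 1)] (mod int l ^ M)"
    using p_gt_1 by (intro poly_cong_at_k) auto
  then have FN: "[poly F (int k) = N] (mod int l ^ M)" by (simp add: of_int_poly)
  have "{1..<p} = insert 1 {2..<p}" using p_gt_1 by auto
  then have F: "poly F (int k) = poly a (int k) * (\<Prod>t\<in>{2..<p}. poly a (int k ^ t))"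
    by (simp add: F_def poly_prod poly_pcompose poly_monom)
  have dvd_iff: "int l ^ i dvd poly F (int k) \<longleftrightarrow> int l ^ i dvd N" if "i \<le> M" for i
    using cong_dvd_iff[OF cong_dvd_modulus[OF FN le_imp_power_dvd[OF that]]] .
  have "int l ^ p dvd N" using dvd_iff[of p] M F a(2) by simp
  then have "l ^ p dvd l ^ j" using j by (metis dvd_abs_iff int_dvd_int_iff of_nat_power)
  then have "p \<le> j" using l_prime prime_gt_1_nat by (metis power_dvd_imp_le)
  \<comment> \<open>A larger exponent would make \<open>l ^ (p + 1)\<close> divide
    \<open>a(k)\<close>, hence also \<open>l ^ p\<close>, because \<open>a * b\<close> represents
    \<open>l ^ p\<close>.\<close>
  moreover have "j \<le> p"
  proof (rule ccontr)
    assume "\<not> j \<le> p"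
    then have "int l ^ Suc p dvd \<bar>N\<bar>" unfolding j by (intro le_imp_power_dvd) simp
    then have "int l ^ Suc p dvd poly a (int k) * (\<Prod>t\<in>{2..<p}. poly a (int k ^ t))"
      using dvd_iff[of "Suc p"] M F by simp
    moreover have "coprime (int l ^ Suc p) (\<Prod>t\<in>{2..<p}. poly a (int k ^ t))"
      using cop by (intro prod_coprime_right) (auto simp: coprime_commute)
    ultimately have d: "int l ^ Suc p dvd poly a (int k)"
      by (simp only: coprime_dvd_mult_left_iff)
    have "[poly (a * b) (int k ^ 1) = poly (of_int (int l ^ p)) (int k ^ 1)] (mod int l ^ M)"
      using p_gt_1 by (intro poly_cong_at_k b) auto
    then have "[poly a (int k) * poly b (int k) = int l ^ p] (mod int l ^ M)"
      by (simp only: of_int_poly poly_mult power_one_right) simp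
    then have "[poly a (int k) * poly b (int k) = int l ^ p] (mod int l ^ Suc p)"
      using M by (meson cong_dvd_modulus le_imp_power_dvd Suc_leI)
    then have "int l ^ Suc p dvd int l ^ p" using d cong_dvd_iff dvd_mult2 by blast
    then have "Suc p \<le> p" using l_prime prime_gt_1_nat
      by (metis power_dvd_imp_le int_dvd_int_iff of_nat_power)
    then show False by simp
  qed
  ultimately show ?thesis using that[of a N] a(1) N j cop by simp
qed

end

theorem mainTheorem7:
  fixes p v m l :: nat and zp zq A D :: complex
    and \<Gamma> :: "complex set set set" and Q :: "complex set"
  defines "R \<equiv> cyc_int zp p"
    and "\<sigma> \<equiv> gal_aut zp p v"
    and "\<mu> \<equiv> v ^ (2 * m + 1) mod p"
    and "lam \<equiv> zp - 1"
  assumes p_prime: "prime p" and p_odd: "odd p"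
    and zp_prim: "zp ^ p = 1" "zp \<noteq> 1"
    and v_prim: "residue_primroot p v"
    and irregular: "p dvd class_number R"
    and plus_reg: "\<not> p dvd class_number (cyc_int_plus zp p)"
    and m_bounds: "1 \<le> m" "m \<le> (p - 3) div 2"
    and \<Gamma>_sub: "\<Gamma> \<subseteq> class_group_carrier R"
    and \<Gamma>_card: "card \<Gamma> = p"
    and \<Gamma>_one: "ideal_class R R \<in> \<Gamma>"
    and \<Gamma>_mult: "\<forall>I\<in>nz_ideals R. \<forall>J\<in>nz_ideals R. ideal_class R I \<in> \<Gamma> \<longrightarrow>
                   ideal_class R J \<in> \<Gamma> \<longrightarrow> ideal_class R (ideal_prod R I J) \<in> \<Gamma>"
    and \<Gamma>_ann: "\<forall>I\<in>nz_ideals R. ideal_class R I \<in> \<Gamma> \<longrightarrow>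
                   ideal_class R (\<sigma> ` I) = ideal_class R (ideal_pow R I \<mu>)"
    and Q_prime: "prime_ideal R Q" "Q \<noteq> {0}"
    and Q_nonprinc: "\<not> is_principal R Q"
    and l_prime: "prime l"
    and Q_over_l: "of_nat l \<in> Q"
    and Q_deg1: "\<forall>x\<in>R. \<exists>k::int. x - of_int k \<in> Q"
    and Q_class: "ideal_class R Q \<in> \<Gamma>"
    and A_int: "A \<in> R"
    and A_gen: "principal R A = ideal_pow R Q p"
    and A_sigma: "\<exists>\<alpha>\<in>cyc_field zp p. \<sigma> A = A ^ \<mu> * \<alpha> ^ p"
    and A_cong: "(\<exists>c\<in>R. A - 1 = lam ^ (2 * m + 1) * c)"
                "\<not> (\<exists>c\<in>R. A - 1 = lam ^ (2 * m + 2) * c)"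
    and D_int: "D \<in> cyc_int_plus zp p"
    and A_D: "A * cnj A = D ^ p"
    and zq_prim: "zq ^ l = 1" "zq \<noteq> 1"
  shows "(gauss_sum zp p zq l Q / cnj (gauss_sum zp p zq l Q)) ^ (p ^ 2)
           = P_sigma_pow zp p v (A ^ 2 / D ^ p)"
proof -
  interpret degree_one_prime p zp l Q
    using p_prime p_odd zp_prim Q_prime(1) Q_nonprinc l_prime Q_over_l Q_deg1
    by unfold_locales (auto simp: R_def)
  \<comment> \<open>This precision is the exponent of \<open>l\<close> in the product of the
    Stickelberger powers of \<open>a\<close> and its cofactor.\<close>
  define M where "M = p * \<Sum>{1..<p}"
  have pM: "p < M"
  proof -
    have "p - 1 \<le> \<Sum>{1..<p}" using p_gt_1 by (intro member_le_sum) auto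
    then have "2 \<le> \<Sum>{1..<p}" using p_ge_3 by linarith
    then have "p * 2 \<le> M" unfolding M_def by (rule mult_le_mono2)
    then show ?thesis using p_gt_1 by linarith
  qed
  then have "M > 0" by simp
  then obtain k where k: "split_prime p zp l M k" "zp - of_int (int k) \<in> Q"
    by (rule split_prime_exists)
  interpret split_prime p zp l M k by (rule k(1))
  interpret degree_one_gauss p zp l Q M k zq
    using zq_prim k(2) by unfold_locales auto
  obtain a N where a: "A = ev a zp" "(\<Prod>t\<in>{1..<p}. ev a (zp ^ t)) = of_int N" "\<bar>N\<bar> = int l ^ p"
    "\<And>t. t \<in> {2..<p} \<Longrightarrow> coprime (poly a (int k ^ t)) (int l)"
    using generator_norm[OF _ _ pM, of A] A_int A_gen unfolding R_def by metis
  have N0: "N \<noteq> 0" using a(3) l_prime prime_gt_0_nat by fastforce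
  have cong: "congR ((zp - 1)\<^sup>2) (ev a zp) 1"
  proof -
    obtain c where c: "c \<in> R" "A - 1 = lam ^ (2 * m + 1) * c" using A_cong(1) by blast
    \<comment> \<open>The exponent \<open>2 * m + 1\<close> is at least 3, so \<open>A\<close> is 1
      modulo \<open>lam\<^sup>2\<close>.\<close>
    have "2 * m + 1 = 2 + (2 * m - 1)" using m_bounds(1) by simp
    then have "A - 1 = (zp - 1)\<^sup>2 * ((zp - 1) ^ (2 * m - 1) * c)"
      using c(2) unfolding lam_def by (metis mult.assoc power_add)
    moreover have "(zp - 1) ^ (2 * m - 1) * c \<in> cyc_int zp p" using c(1) by (auto simp: R_def)
    ultimately show ?thesis unfolding congR_def a(1)[symmetric] by blast
  qed
  have g: "gauss_sum zp p zq l Q ^ p\<^sup>2 = - stickelberger_pow a"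
    unfolding gauss_sum_eq_G by (rule gauss_sum_power_eq[OF a(2,3,4) M_def cong])
  have "A \<noteq> 0"
  proof
    assume "A = 0"
    then have "(\<Prod>t\<in>{1..<p}. ev a (zp ^ t)) = 0" using a(1) p_gt_1 by (intro prod_zero) (auto intro: bexI[of _ 1])
    then show False using a(2) N0 by (metis of_int_eq_0_iff)
  qed
  \<comment> \<open>Substituting \<open>D ^ p = A * cnj A\<close> cancels one factor
    \<open>A\<close>.\<close>
  then have "A ^ 2 / D ^ p = ev a zp / cnj (ev a zp)"
    unfolding A_D[symmetric] a(1)[symmetric] by (simp add: power2_eq_square)
  then have "P_sigma_pow zp p v (A ^ 2 / D ^ p) = stickelberger_pow a / cnj (stickelberger_pow a)"
    using P_sigma_pow_quotient[OF v_prim a(2) N0] by simp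
  moreover have "(gauss_sum zp p zq l Q / cnj (gauss_sum zp p zq l Q)) ^ (p ^ 2) = stickelberger_pow a / cnj (stickelberger_pow a)"
    unfolding power_divide complex_cnj_power[symmetric] g by simp
  ultimately show ?thesis by simp
qed

end
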